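(* Let $S\subset Y$ be a compact open set containing all of the archimedean places, i.e. $Y(\mathbb{Q},\infty)\subseteq S$, and let $\mathcal{F}(S)=\{f\in\mathcal{F}:\operatorname{supp}(f)\subseteq S\}$. Let $f^{(1)},\ldots,f^{(n)}\in\mathcal{F}(S)$ and suppose there exist $r_1,\ldots,r_n\in\mathbb{R}$, not all zero, such that $\sum_{i=1}^n r_i f^{(i)}=0$. Then there exist $s_1,\ldots,s_n\in\mathbb{Q}$, not all zero, such that $\sum_{i=1}^n s_i f^{(i)}=0$.
   Context: Number fields are finite extensions of $\mathbb{Q}$ inside a fixed algebraic closure $\overline{\mathbb{Q}}$. For a number field $K$, $M_K$ is its set of places; for $v\in M_K$ lying over the rational place $p$ (a prime or $\infty$), $\|\cdot\|_v$ is the absolute value on $K$ extending the usual absolute value $|\cdot|_p$ on $\mathbb{Q}$. Give each $M_K$ the discrete topology; for $L/K$ an extension of number fields let $M_L\to M_K$ be restriction of places. Put $Y=\varprojlim_K M_K$ over all number fields $K$: a locally compact, totally disconnected Hausdorff space whose points are the places of $\overline{\mathbb{Q}}$. For $v\in M_K$ let $Y(K,v)=\{y\in Y: y\mid v\}$ (the points whose image in $M_K$ is $v$); these sets form a basis of the topology. The archimedean places are exactly the points of $Y(\mathbb{Q},\infty)$. For $\alpha\in K^\times$ and $y\in Y(K,v)$, $\|\alpha\|_y=\|\alpha\|_v$. For $\alpha\in\overline{\mathbb{Q}}^\times$ let $f_\alpha:Y\to\mathbb{R}$, $f_\alpha(y)=\log\|\alpha\|_y$; it lies in $C_c(Y)$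 and depends only on the class of $\alpha$ modulo roots of unity. $\mathcal{F}=\{f_\alpha:\alpha\in\overline{\mathbb{Q}}^\times/\operatorname{Tor}(\overline{\mathbb{Q}}^\times)\}\subset C_c(Y)$, a $\mathbb{Q}$-vector space. *)

theory Defs
  imports "HOL-Analysis.Analysis" "HOL-Computational_Algebra.Primes" "HOL-Computational_Algebra.Polynomial"
begin

text \<open>
  The fixed algebraic closure of the rationals is the field of algebraic numbers inside
  \<^typ>\<open>complex\<close>. A number field is thus a subset of \<^typ>\<open>complex\<close>; finiteness over
  the rationals forces its elements to be algebraic.
\<close>

definition number_field :: "complex set \<Rightarrow> bool" where
  "number_field K \<longleftrightarrow>
     0 \<in> K \<and> 1 \<in> K \<and>
     (\<forall>x\<in>K. \<forall>y\<in>K. x + y \<in> K \<and> x * y \<in> K) \<and>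
     (\<forall>x\<in>K. - x \<in> K \<and> inverse x \<in> K) \<and>
     (\<exists>B. finite B \<and> K = module.span (\<lambda>(q::rat) (x::complex). of_rat q * x) B)"

definition padic_abs :: "nat \<Rightarrow> rat \<Rightarrow> real" where
  "padic_abs p q =
     (if q = 0 then 0
      else real p powi
        (int (multiplicity (int p) (snd (quotient_of q)))
          - int (multiplicity (int p) (fst (quotient_of q)))))"

definition usual_abs_values :: "(rat \<Rightarrow> real) set" where
  "usual_abs_values = insert (\<lambda>q. of_rat \<bar>q\<bar>) {padic_abs p | p. prime p}"

text \<open>
  Absolute values on a number field are extensional functions, i.e. they are \<^const>\<open>undefined\<close>
  outside \<open>K\<close>, so that they are determined by their values on \<open>K\<close>.
\<close>

definition nontrivial_abs_values :: "complex set \<Rightarrow> (complex \<Rightarrow> real) set" where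
  "nontrivial_abs_values K =
     {a \<in> extensional K.
        (\<forall>x\<in>K. a x \<ge> 0 \<and> (a x = 0 \<longleftrightarrow> x = 0)) \<and>
        (\<forall>x\<in>K. \<forall>y\<in>K. a (x * y) = a x * a y \<and> a (x + y) \<le> a x + a y) \<and>
        (\<exists>x\<in>K. x \<noteq> 0 \<and> a x \<noteq> 1)}"

definition abs_value_equiv :: "complex set \<Rightarrow> ((complex \<Rightarrow> real) \<times> (complex \<Rightarrow> real)) set" where
  "abs_value_equiv K =
     {(a, b) \<in> nontrivial_abs_values K \<times> nontrivial_abs_values K.
        \<exists>t>0. \<forall>x\<in>K. b x = a x powr t}"

type_synonym place = "(complex \<Rightarrow> real) set"

definition places :: "complex set \<Rightarrow> place set" where
  "places K = nontrivial_abs_values K // abs_value_equiv K"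

definition restrict_place :: "complex set \<Rightarrow> place \<Rightarrow> place" where
  "restrict_place K w = (\<Union>a\<in>w. abs_value_equiv K `` {restrict a K})"

text \<open>The normalized absolute value of a place: its representative extending the usual absolute
  value of the rational place below it.\<close>

definition place_abs :: "place \<Rightarrow> complex \<Rightarrow> real" where
  "place_abs v = (THE a. a \<in> v \<and> (\<exists>\<phi>\<in>usual_abs_values. \<forall>q. a (of_rat q) = \<phi> q))"

definition infinite_place :: place where
  "infinite_place = abs_value_equiv \<rat> `` {\<lambda>x\<in>\<rat>. norm x}"

text \<open>A point of the inverse limit is a compatible family of places indexed by number fields.\<close>

type_synonym point = "complex set \<Rightarrow> place"

definition compatible_families :: "point set" where
  "compatible_families =
     {y \<in> Pi\<^sub>E (Collect number_field) places.
        \<forall>K L. number_field K \<and> number_field L \<and> K \<subseteq> L \<longrightarrow> restrict_place K (y L) = y K}"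

definition Y_top :: "point topology" where
  "Y_top = subtopology
     (product_topology (\<lambda>K. discrete_topology (places K)) (Collect number_field))
     compatible_families"

definition Y_over :: "complex set \<Rightarrow> place \<Rightarrow> point set" where
  "Y_over K v = {y \<in> topspace Y_top. y K = v}"

definition point_abs :: "point \<Rightarrow> complex \<Rightarrow> real" where
  "point_abs y \<alpha> =
     (THE r. \<exists>K v. number_field K \<and> \<alpha> \<in> K \<and> v \<in> places K \<and> y \<in> Y_over K v \<and>
        r = place_abs v \<alpha>)"

definition log_fun :: "complex \<Rightarrow> point \<Rightarrow> real" where
  "log_fun \<alpha> = (\<lambda>y\<in>topspace Y_top. ln (point_abs y \<alpha>))"

text \<open>Indexing by nonzero algebraic numbers, rather than by their classes modulo roots of unity,
  gives the same set of functions.\<close>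

definition log_funs :: "(point \<Rightarrow> real) set" where
  "log_funs = {log_fun \<alpha> | \<alpha>. algebraic \<alpha> \<and> \<alpha> \<noteq> 0}"

definition supp :: "(point \<Rightarrow> real) \<Rightarrow> point set" where
  "supp f = Y_top closure_of {y \<in> topspace Y_top. f y \<noteq> 0}"

definition log_funs_supported :: "point set \<Rightarrow> (point \<Rightarrow> real) set" where
  "log_funs_supported S = {f \<in> log_funs. supp f \<subseteq> S}"

end

theory Submission
  imports Defs "HOL-Computational_Algebra.Fundamental_Theorem_Algebra"
begin

text \<open>
  The \<open>i\<close>-th function comes from some \<open>\<alpha> i\<close>, and all \<open>\<alpha> i\<close> lie in one number field \<open>K\<close>. For every
  natural \<open>N\<close> round \<open>N M r\<close>, for a fixed large \<open>M\<close>, to an integer vector \<open>s N\<close> and let \<open>\<beta> N = (\<Prod>i. \<alpha> i powi s N i)\<close>. By the real relation,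
  \<open>log \<parallel>\<beta> N\<parallel>\<close> differs from zero at each place only by the rounding error, so it is bounded uniformly
  in \<open>N\<close> and in the place. Hence the coefficients of the minimal polynomial of \<open>\<beta> N\<close> over the rationals
  are bounded at all places of the rationals, and since the degree is bounded too, only finitely many
  numbers \<open>\<beta> N\<close> occur. If \<open>\<beta> N = \<beta> N'\<close> with \<open>N \<noteq> N'\<close>, then \<open>s N - s N'\<close> is a nontrivial integral relation.

  The normalized absolute values needed are supplied by Ostrowski's theorem (every place has one),
  by Chevalley's construction (the \<open>p\<close>-adic one extends to all algebraic numbers), and by embeddings of
  the field of algebraic numbers (they reach all conjugates).
\<close>

section \<open>Subrings and number fields\<close>

text \<open>A real relation only makes integral combinations bounded; a discreteness statement has
  to turn boundedness into coincidence. The one used, \<open>northcott\<close>, works through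
  minimal polynomials and hence through conjugates, which may lie outside \<open>K\<close>. Bounds
  are therefore stated for all normalized absolute values \<open>A\<close> on the algebraic numbers,
  a class that is stable under composition with embeddings. Points of \<open>Y_top\<close> are
  families of equivalence classes, so two bridges connect them with absolute values. Each
  \<open>A\<close> yields a point, which carries the given real relation over to \<open>A\<close>;
  each point yields a normalized absolute value on \<open>K\<close>, which carries the integral
  relation back to the point. Applying the pigeonhole principle to the numbers themselves instead of
  their logarithms makes the final relation exact at all points at once.\<close>

definition is_subring :: "'a::comm_ring_1 set \<Rightarrow> bool" where
  "is_subring R \<longleftrightarrow> 0 \<in> R \<and> 1 \<in> R \<and> (\<forall>x\<in>R. \<forall>y\<in>R. x + y \<in> R \<and> x * y \<in> R) \<and> (\<forall>x\<in>R. - x \<in> R)"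

lemma is_subringD:
  assumes "is_subring R"
  shows "0 \<in> R" "1 \<in> R" "\<And>x y. x \<in> R \<Longrightarrow> y \<in> R \<Longrightarrow> x + y \<in> R"
    "\<And>x y. x \<in> R \<Longrightarrow> y \<in> R \<Longrightarrow> x * y \<in> R" "\<And>x. x \<in> R \<Longrightarrow> - x \<in> R"
    "\<And>x y. x \<in> R \<Longrightarrow> y \<in> R \<Longrightarrow> x - y \<in> R"
  using assms unfolding is_subring_def by (auto simp flip: add_uminus_conv_diff)

lemma is_subring_power: "is_subring R \<Longrightarrow> x \<in> R \<Longrightarrow> x ^ n \<in> R"
  by (induction n) (auto simp: is_subringD)

lemma is_subring_sum: "is_subring R \<Longrightarrow> (\<And>i. i \<in> I \<Longrightarrow> f i \<in> R) \<Longrightarrow> sum f I \<in> R"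
  by (induction I rule: infinite_finite_induct) (auto simp: is_subringD)

lemma is_subring_prod: "is_subring R \<Longrightarrow> (\<And>i. i \<in> I \<Longrightarrow> f i \<in> R) \<Longrightarrow> prod f I \<in> R"
  by (induction I rule: infinite_finite_induct) (auto simp: is_subringD)

lemma is_subring_of_nat: "is_subring R \<Longrightarrow> of_nat n \<in> R"
  by (induction n) (auto simp: is_subringD)

lemma is_subring_of_int: "is_subring R \<Longrightarrow> of_int n \<in> R"
  by (cases n) (simp_all only: of_int_of_nat_eq of_int_minus is_subring_of_nat is_subringD)

lemma is_subring_poly:
  assumes "is_subring R" "\<And>i. coeff p i \<in> R" "x \<in> R"
  shows "poly p x \<in> R"
  unfolding poly_altdef using assms by (auto intro!: is_subring_sum is_subringD(4) is_subring_power)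

text \<open>Dividing an integral relation with nonzero constant term \<open>c\<close> by
  \<open>x\<close> gives \<open>x * poly q x = - c\<close>, which exhibits the inverse. Thus a ring
  of algebraic numbers containing the rationals is a field.\<close>

lemma inverse_mem_subring:
  fixes x :: complex
  assumes R: "is_subring R" and Q: "\<And>q. of_rat q \<in> R" and "x \<in> R" "algebraic x"
  shows "inverse x \<in> R"
proof (cases "x = 0")
  case False
  then obtain p where p: "\<And>i. coeff p i \<in> \<int>" "coeff p 0 \<noteq> 0" "poly p x = 0"
  proof -
    obtain r :: "int poly" where "coeff r 0 \<noteq> 0" "poly (map_poly of_int r) x = 0"
      using algebraicE'_nonzero[OF \<open>algebraic x\<close> False] by metis
    then show thesis by (intro that[of "map_poly of_int r"]) (auto simp: coeff_map_poly)
  qed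
  obtain c q where pc: "p = pCons c q" by (cases p)
  have *: "x * poly q x = - c" using p(3) pc by (simp add: add_eq_0_iff)
  have "poly q x \<in> R"
  proof (rule is_subring_poly[OF R _ \<open>x \<in> R\<close>])
    fix i show "coeff q i \<in> R" 
      using p(1)[of "Suc i"] pc is_subring_of_int[OF R] by (auto elim!: Ints_cases)
  qed
  moreover obtain k where k: "c = of_int k" using p(1)[of 0] pc by (auto elim!: Ints_cases)
  have "inverse c \<in> R" using Q[of "inverse (of_int k)"] k by (simp add: of_rat_inverse)
  moreover have "inverse x = - (inverse c) * poly q x"
    using * False p(2) pc by (simp add: field_simps)
  ultimately show ?thesis using R by (auto intro!: is_subringD)
qed (use R is_subringD in auto)

text \<open>Turns the span in \<open>number_field\<close> into the span of a vector space, so that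
  dimension theory applies to it.\<close>

interpretation rat_vs: vector_space "\<lambda>(q::rat) (x::complex). of_rat q * x"
  by standard (auto simp: algebra_simps of_rat_add of_rat_mult)

lemma number_field_subring: "number_field K \<Longrightarrow> is_subring K"
  unfolding number_field_def is_subring_def by auto

lemma number_field_inverse: "number_field K \<Longrightarrow> x \<in> K \<Longrightarrow> inverse x \<in> K"
  unfolding number_field_def by auto

lemma number_field_of_rat: "number_field K \<Longrightarrow> of_rat q \<in> K"
proof -
  assume K: "number_field K"
  then obtain B where B: "K = rat_vs.span B" unfolding number_field_def by auto
  have "1 \<in> K" using K unfolding number_field_def by auto
  then have "of_rat q * 1 \<in> K" unfolding B by (rule rat_vs.span_scale)
  then show ?thesis by simp
qed

text \<open>The powers with exponents 0 to \<open>card B\<close> are one more than the dimension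
  allows.\<close>

lemma power_dependence:
  assumes "finite B" and x: "\<And>i. (x::complex) ^ i \<in> rat_vs.span B"
  shows "\<exists>p. p \<noteq> 0 \<and> degree p \<le> card B \<and> (\<forall>i. coeff p i \<in> \<rat>) \<and> poly p x = 0"
\<comment> \<open>Dependence concerns the set of powers, so coinciding powers are treated apart;
  they give a difference of two monomials.\<close>
proof (cases "inj_on (\<lambda>i. x ^ i) {..card B}")
  case True
  let ?T = "(\<lambda>i. x ^ i) ` {..card B}"
  have "card ?T = Suc (card B)" using True by (simp add: card_image)
  then have "rat_vs.dependent ?T"
    using rat_vs.independent_span_bound[OF \<open>finite B\<close>, of ?T] x by auto
  then obtain u v where u: "v \<in> ?T" "u v \<noteq> 0" "(\<Sum>v\<in>?T. of_rat (u v) * v) = 0"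
    by (subst (asm) rat_vs.dependent_finite) auto
  define p where "p = (\<Sum>i\<le>card B. monom (of_rat (u (x ^ i)) :: complex) i)"
  have c: "coeff p i = (if i \<le> card B then of_rat (u (x ^ i)) else 0)" for i
    unfolding p_def by (simp add: coeff_sum sum.delta)
  obtain i where i: "i \<le> card B" "v = x ^ i" using u(1) by auto
  have "coeff p i \<noteq> 0" using i u(2) by (simp add: c)
  then have "p \<noteq> 0" by auto
  moreover have "degree p \<le> card B" by (rule degree_le) (simp add: c)
  moreover have "poly p x = (\<Sum>i\<le>card B. of_rat (u (x ^ i)) * x ^ i)"
    unfolding p_def by (simp add: poly_sum poly_monom)
  then have "poly p x = 0" using u(3) by (simp add: sum.reindex[OF True])
  ultimately show ?thesis by (auto simp: c intro!: exI[of _ p])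
next
  case False
  then obtain i j where ij: "i \<le> card B" "j \<le> card B" "i \<noteq> j" "x ^ i = x ^ j"
    unfolding inj_on_def by auto
  define p where "p = monom (1::complex) i - monom 1 j"
  have "coeff p i \<noteq> 0" using ij by (simp add: p_def)
  then have "p \<noteq> 0" by auto
  moreover have "degree p \<le> card B" using ij unfolding p_def
    by (intro degree_diff_le) (auto intro: order.trans[OF degree_monom_le])
  moreover have "poly p x = 0" using ij by (simp add: p_def poly_monom)
  ultimately show ?thesis by (auto simp: p_def intro!: exI[of _ p])
qed

text \<open>The powers of every \<open>x\<close> stay in the span of the same finite
  \<open>B\<close>, so \<open>card B\<close> serves for all \<open>x\<close> at once.\<close>

lemma number_field_degree_bound:
  assumes "number_field K"
  obtains d where "\<And>x. x \<in> K \<Longrightarrow> \<exists>p. p \<noteq> 0 \<and> degree p \<le> d \<and> (\<forall>i. coeff p i \<in> \<rat>) \<and> poly p x = 0"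
proof -
  obtain B where B: "finite B" "K = rat_vs.span B" using assms unfolding number_field_def by auto
  have pw: "x ^ i \<in> rat_vs.span B" if "x \<in> K" for x i
    using is_subring_power[OF number_field_subring[OF assms] that] B(2) by simp
  have "\<exists>p. p \<noteq> 0 \<and> degree p \<le> card B \<and> (\<forall>i. coeff p i \<in> \<rat>) \<and> poly p x = 0" if "x \<in> K" for x
    by (rule power_dependence[OF B(1)]) (rule pw[OF that])
  then show ?thesis by (rule that)
qed

lemma number_field_algebraic: "number_field K \<Longrightarrow> x \<in> K \<Longrightarrow> algebraic x"
  by (metis number_field_degree_bound algebraicI')

text \<open>Intersections are where values computed in two different fields get compared. A basis of
  the intersection is finite, being independent inside the finite-dimensional
  \<open>K\<close>.\<close>

lemma number_field_Int:
  assumes K: "number_field K" and L: "number_field L"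
  shows "number_field (K \<inter> L)"
proof -
  obtain B where B: "finite B" "K = rat_vs.span B" using K unfolding number_field_def by auto
  obtain C where C: "L = rat_vs.span C" using L unfolding number_field_def by auto
  obtain D where D: "D \<subseteq> K \<inter> L" "rat_vs.independent D" "K \<inter> L \<subseteq> rat_vs.span D"
    using rat_vs.maximal_independent_subset by blast
  have "finite D" using rat_vs.independent_span_bound[OF B(1) D(2)] D(1) B(2) by auto
  moreover have "rat_vs.subspace (K \<inter> L)"
    unfolding B C by (intro rat_vs.subspace_inter rat_vs.subspace_span)
  then have "rat_vs.span D = K \<inter> L"
    using D rat_vs.span_minimal by blast
  ultimately have "\<exists>B. finite B \<and> K \<inter> L = rat_vs.span B" by auto
  with K L show ?thesis unfolding number_field_def by auto
qed

lemma number_field_Rats: "number_field \<rat>"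
proof -
  have "\<rat> = rat_vs.span {1::complex}"
    by (auto simp: rat_vs.span_singleton Rats_def)
  then have "\<exists>B. finite B \<and> (\<rat>::complex set) = rat_vs.span B" by blast
  then show ?thesis unfolding number_field_def by auto
qed

section \<open>Adjoining algebraic numbers to a number field\<close>

lemma monic_rat_poly:
  assumes "algebraic (x::complex)"
  obtains m q where "m > 0" "x ^ m = (\<Sum>j<m. of_rat (q j) * x ^ j)"
proof -
  obtain p where p: "\<And>i. coeff p i \<in> \<rat>" "p \<noteq> 0" "poly p x = 0"
    using assms unfolding algebraic_altdef by blast
  define m where "m = degree p"
  have c: "coeff p m \<noteq> 0" using p(2) m_def by simp
  have "m > 0" 
  proof (rule ccontr)
    assume "\<not> m > 0"
    then obtain a where "p = [:a:]" using m_def by (auto elim: degree_eq_zeroE)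
    then show False using p(2,3) by simp
  qed
  have "\<forall>j. \<exists>q. coeff p j / coeff p m = - of_rat q"
    using p(1) by (metis Rats_cases Rats_divide Rats_minus_iff minus_minus)
  then obtain q where q: "\<And>j. coeff p j / coeff p m = - of_rat (q j)" by metis
  have "0 = (\<Sum>j<m. coeff p j * x ^ j) + coeff p m * x ^ m"
    using p(3) unfolding poly_altdef m_def[symmetric] lessThan_Suc_atMost[symmetric] by simp
  then have "x ^ m = - (\<Sum>j<m. coeff p j * x ^ j) / coeff p m"
    using c by (simp add: field_simps add_eq_0_iff)
  also have "\<dots> = (\<Sum>j<m. - (coeff p j / coeff p m) * x ^ j)"
    by (simp add: sum_divide_distrib sum_negf[symmetric])
  finally show ?thesis using that[OF \<open>m > 0\<close>, of q] by (simp add: q)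
qed

text \<open>\<open>L\<close> is spanned by products of generators of \<open>K\<close> with powers of
  \<open>a\<close> below \<open>m\<close>. Closure under multiplication is reached in stages: by
  \<open>K\<close>, by \<open>a\<close>, by powers of \<open>a\<close>, and finally by
  \<open>L\<close> itself. Inverses then come from algebraicity.\<close>

lemma number_field_adjoin:
  assumes K: "number_field K" and a: "algebraic a"
  obtains L where "number_field L" "K \<subseteq> L" "a \<in> L"
proof -
  obtain B where B: "finite B" "K = rat_vs.span B" using K unfolding number_field_def by auto
  note KR = number_field_subring[OF K]
  obtain m q where m: "m > 0" "a ^ m = (\<Sum>j<m. of_rat (q j) * a ^ j)" using monic_rat_poly[OF a] .
  define G where "G = (\<lambda>(b,i). b * a ^ i) ` (B \<times> {..<m})"
  define L where "L = rat_vs.span G"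
  have fG: "finite G" unfolding G_def using B by auto
  have Kai: "c * a ^ i \<in> L" if "c \<in> K" "i < m" for c i
    using that(1) unfolding B
  proof (induction rule: rat_vs.span_induct_alt)
    case base show ?case using rat_vs.span_zero by (simp add: L_def)
  next
    case (step r b y)
    have "b * a ^ i \<in> L" unfolding L_def G_def using step(1) that(2) by (auto intro!: rat_vs.span_base)
    then have "of_rat r * (b * a ^ i) + y * a ^ i \<in> L"
      using step(2) unfolding L_def by (intro rat_vs.span_add rat_vs.span_scale)
    then show ?case by (simp add: algebra_simps)
  qed
  have KL: "c * y \<in> L" if c: "c \<in> K" and y: "y \<in> L" for c y
    using y unfolding L_def
  proof (induction rule: rat_vs.span_induct_alt)
    case base show ?case using rat_vs.span_zero by simp
  next
    case (step r g y)
    obtain b i where bi: "b \<in> B" "i < m" "g = b * a ^ i" using step(1) G_def by auto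
    have "b \<in> K" unfolding B using bi by (auto intro: rat_vs.span_base)
    then have "(c * b) * a ^ i \<in> L" using c KR bi by (intro Kai is_subringD)
    then have "of_rat r * ((c * b) * a ^ i) + c * y \<in> rat_vs.span G"
      using step(2) unfolding L_def by (intro rat_vs.span_add rat_vs.span_scale)
    moreover have "of_rat r * ((c * b) * a ^ i) + c * y = c * (of_rat r * g + y)"
      using bi by (simp add: algebra_simps)
    ultimately show ?case by metis
  qed
  have aL: "a * y \<in> L" if y: "y \<in> L" for y
    using y unfolding L_def
  proof (induction rule: rat_vs.span_induct_alt)
    case base show ?case using rat_vs.span_zero by simp
  next
    case (step r g y)
    obtain b i where bi: "b \<in> B" "i < m" "g = b * a ^ i" using step(1) G_def by auto
    have b: "b \<in> K" unfolding B using bi by (auto intro: rat_vs.span_base)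
    have "b * a ^ Suc i \<in> L"
    proof (cases "Suc i < m")
      case True then show ?thesis using Kai b by blast
    next
      case False
      then have "Suc i = m" using bi by simp
      \<comment> \<open>The exponent has just left the range; the monic relation brings it back
        below \<open>m\<close>.\<close>
      then have "b * a ^ Suc i = (\<Sum>j<m. of_rat (q j) * (b * a ^ j))"
        using m(2) by (simp add: sum_distrib_left algebra_simps)
      also have "\<dots> \<in> L" unfolding L_def
        by (intro rat_vs.span_sum rat_vs.span_scale) (use Kai b in \<open>auto simp: L_def\<close>)
      finally show ?thesis .
    qed
    then have "of_rat r * (b * a ^ Suc i) + a * y \<in> rat_vs.span G"
      using step(2) unfolding L_def by (intro rat_vs.span_add rat_vs.span_scale)
    moreover have "of_rat r * (b * a ^ Suc i) + a * y = a * (of_rat r * g + y)"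
      using bi by (simp add: algebra_simps)
    ultimately show ?case by metis
  qed
  have aiL: "a ^ i * y \<in> L" if y: "y \<in> L" for y i
    using y by (induction i) (auto simp: mult.assoc intro: aL)
  have LL: "x * y \<in> L" if x: "x \<in> L" and y: "y \<in> L" for x y
    using x unfolding L_def
  proof (induction rule: rat_vs.span_induct_alt)
    case base show ?case using rat_vs.span_zero by simp
  next
    case (step r g z)
    obtain b i where bi: "b \<in> B" "i < m" "g = b * a ^ i" using step(1) G_def by auto
    have b: "b \<in> K" unfolding B using bi by (auto intro: rat_vs.span_base)
    then have "b * (a ^ i * y) \<in> L" using aiL y KL by blast
    then have "of_rat r * (b * (a ^ i * y)) + z * y \<in> rat_vs.span G"
      using step(2) unfolding L_def by (intro rat_vs.span_add rat_vs.span_scale)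
    moreover have "of_rat r * (b * (a ^ i * y)) + z * y = (of_rat r * g + z) * y"
      using bi by (simp add: algebra_simps)
    ultimately show ?case by metis
  qed
  have KsubL: "K \<subseteq> L" using Kai[of _ 0] m(1) by auto
  have oneL: "1 \<in> L" using KsubL KR is_subringD by blast
  have a_L: "a \<in> L" using aL[OF oneL] by simp
  have RL: "is_subring L"
    unfolding is_subring_def using LL oneL rat_vs.span_zero rat_vs.span_add rat_vs.span_neg by (auto simp: L_def)
  have QL: "of_rat q \<in> L" for q using number_field_of_rat[OF K] KsubL by blast
  have alg: "algebraic x" if "x \<in> L" for x
  proof -
    have "x ^ i \<in> rat_vs.span G" for i using is_subring_power[OF RL that] by (simp add: L_def)
    from power_dependence[OF fG this] show ?thesis using algebraicI' by metis
  qed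
  have "inverse x \<in> L" if "x \<in> L" for x using inverse_mem_subring[OF RL QL that alg[OF that]] .
  then have "number_field L" 
    unfolding number_field_def using RL fG L_def by (auto simp: is_subringD)
  then show ?thesis using that KsubL a_L by blast
qed

lemma number_field_containing_finite:
  assumes "finite A" "\<And>x. x \<in> A \<Longrightarrow> algebraic x"
  obtains K where "number_field K" "A \<subseteq> K"
proof -
  have "\<exists>K. number_field K \<and> A \<subseteq> K" using assms
  proof (induction A rule: finite_induct)
    case empty show ?case using number_field_Rats by auto
  next
    case (insert x A)
    then obtain K where K: "number_field K" "A \<subseteq> K" by auto
    have "algebraic x" using insert by auto
    with K(1) obtain L where "number_field L" "K \<subseteq> L" "x \<in> L" by (rule number_field_adjoin)
    then show ?case using K by auto
  qed
  then show ?thesis using that by auto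
qed

abbreviation Qbar :: "complex set" where "Qbar \<equiv> {x. algebraic x}"

text \<open>Two algebraic numbers lie in a common number field, all of whose elements are
  algebraic.\<close>

lemma Qbar_subring: "is_subring Qbar"
proof -
  have "x + y \<in> Qbar \<and> x * y \<in> Qbar" if "x \<in> Qbar" "y \<in> Qbar" for x y
  proof -
    have "finite {x, y}" "\<And>z. z \<in> {x, y} \<Longrightarrow> algebraic z" using that by auto
    then obtain K where K: "number_field K" "{x, y} \<subseteq> K"
      by (rule number_field_containing_finite)
    then have "x + y \<in> K" "x * y \<in> K" by (auto intro: is_subringD number_field_subring)
    then show ?thesis using number_field_algebraic[OF K(1)] by auto
  qed
  then show ?thesis unfolding is_subring_def by auto
qed

section \<open>Absolute values and Ostrowski's theorem\<close>

text \<open>A ratio \<open>r > 1\<close> would make \<open>r ^ k\<close> outgrow any linear function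
  of \<open>k\<close>. Estimates with such a linear factor arise from binomial and from digit
  expansions.\<close>

lemma le_of_power_le_linear_mult_power:
  fixes x y c e :: real
  assumes "x \<ge> 0" "y \<ge> 0" and le: "\<And>k::nat. x ^ k \<le> (c * real k + e) * y ^ k"
  shows "x \<le> y"
proof (rule ccontr)
  assume "\<not> x \<le> y"
  show False
  proof (cases "y = 0")
    case True
    then show ?thesis using le[of 1] \<open>\<not> x \<le> y\<close> by simp
  next
    case False
    define r where "r = x / y"
    have y: "y > 0" using assms False by simp
    then have r: "r > 1" using \<open>\<not> x \<le> y\<close> by (simp add: r_def)
    have "1 \<le> c * (real k / r ^ k) + e * (1 / r ^ k)" for k
    proof -
      have "r ^ k \<le> c * real k + e" using le[of k] y by (simp add: r_def power_divide field_simps)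
      then show ?thesis using r by (simp add: field_simps)
    qed
    moreover have "(\<lambda>k. c * (real k / r ^ k) + e * (1 / r ^ k)) \<longlonglongrightarrow> c * 0 + e * 0"
      using r lim_n_over_pown[of r] LIMSEQ_divide_realpow_zero[of r 1] 
      by (intro tendsto_intros) auto
    ultimately have "1 \<le> c * 0 + e * 0" by (intro LIMSEQ_le_const) auto
    then show False by simp
  qed
qed

text \<open>The carrier is only a subring and nothing is required outside it, so that the same facts
  serve the rationals, number fields and the ring of all algebraic numbers.\<close>

locale abs_value =
  fixes F :: "'a::field set" and a :: "'a \<Rightarrow> real"
  assumes subring: "is_subring F"
    and nonneg: "x \<in> F \<Longrightarrow> a x \<ge> 0"
    and eq_0_iff: "x \<in> F \<Longrightarrow> a x = 0 \<longleftrightarrow> x = 0"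
    and mult: "x \<in> F \<Longrightarrow> y \<in> F \<Longrightarrow> a (x * y) = a x * a y"
    and triangle: "x \<in> F \<Longrightarrow> y \<in> F \<Longrightarrow> a (x + y) \<le> a x + a y"
begin

lemma zero [simp]: "a 0 = 0"
  using eq_0_iff is_subringD(1)[OF subring] by blast

lemma one [simp]: "a 1 = 1"
  using mult[of 1 1] eq_0_iff[of 1] is_subringD(2)[OF subring] by simp

lemma uminus: "x \<in> F \<Longrightarrow> a (- x) = a x"
proof -
  assume x: "x \<in> F"
  have m: "-1 \<in> F" using subring by (simp add: is_subringD)
  have "a (-1) * a (-1) = 1" using mult[OF m m] by simp
  then have "(a (-1) - 1) * (a (-1) + 1) = 0" by (simp add: algebra_simps)
  then have "a (-1) = 1" using nonneg[OF m] by auto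
  then show ?thesis using mult[OF m x] by simp
qed

lemma power: "x \<in> F \<Longrightarrow> a (x ^ n) = a x ^ n"
  by (induction n) (auto simp: mult is_subring_power[OF subring])

lemma inverse: "x \<in> F \<Longrightarrow> inverse x \<in> F \<Longrightarrow> a (inverse x) = inverse (a x)"
  using mult[of x "inverse x"] eq_0_iff[of x] by (cases "x = 0") (auto simp: field_simps)

lemma sum_le: "(\<And>i. i \<in> I \<Longrightarrow> f i \<in> F) \<Longrightarrow> a (sum f I) \<le> (\<Sum>i\<in>I. a (f i))"
proof (induction I rule: infinite_finite_induct)
  case (insert x I)
  then show ?case using triangle[of "f x" "sum f I"] is_subring_sum[OF subring, of I f] by auto
qed auto

lemma prod: "(\<And>i. i \<in> I \<Longrightarrow> f i \<in> F) \<Longrightarrow> a (prod f I) = (\<Prod>i\<in>I. a (f i))"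
proof (induction I rule: infinite_finite_induct)
  case (insert x I)
  then show ?case using mult[of "f x" "prod f I"] is_subring_prod[OF subring, of I f] by auto
qed auto

lemma of_nat_le: "a (of_nat n) \<le> real n"
proof (induction n)
  case (Suc n)
  then show ?case using triangle[of 1 "of_nat n"] subring is_subring_of_nat[OF subring] by (auto simp: is_subringD)
qed auto

text \<open>Expanding \<open>(x + y) ^ n\<close> binomially bounds \<open>a (x + y) ^ n\<close> by \<open>n + 1\<close> times the \<open>n\<close>-th power of the
  desired bound; the factor \<open>n + 1\<close> disappears on taking \<open>n\<close>-th roots.\<close>

lemma triangle_powr:
  assumes t: "t > 0" and le: "\<And>n. a (of_nat n) \<le> real n powr t" and x: "x \<in> F" and y: "y \<in> F"
  shows "a (x + y) powr (1 / t) \<le> a x powr (1 / t) + a y powr (1 / t)"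
proof -
  define X where "X = a x powr (1 / t)"
  define Y where "Y = a y powr (1 / t)"
  have XY: "X \<ge> 0" "Y \<ge> 0" "a x = X powr t" "a y = Y powr t" 
    using t nonneg x y by (auto simp: X_def Y_def powr_powr)
  have pw: "(z powr t) ^ k = (z ^ k) powr t" if "z \<ge> 0" for z :: real and k :: nat
    using that by (induction k) (auto simp: powr_mult)
  have pow: "a (x + y) ^ n \<le> (1 * real n + 1) * ((X + Y) powr t) ^ n" for n
  proof -
    let ?f = "\<lambda>k. of_nat (n choose k) * x ^ k * y ^ (n - k)"
    have mem: "of_nat (n choose k) \<in> F" "x ^ k \<in> F" "y ^ (n - k) \<in> F" for k
      using x y subring is_subring_of_nat is_subring_power by blast+
    then have fF: "?f k \<in> F" for k using subring by (simp add: is_subringD)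
    have summand: "a (?f k) \<le> ((X + Y) powr t) ^ n" if "k \<le> n" for k
    proof -
      have "a (?f k) = a (of_nat (n choose k)) * (X powr t) ^ k * (Y powr t) ^ (n - k)"
        using mem x y XY subring by (simp add: mult power is_subringD)
      also have "\<dots> \<le> real (n choose k) powr t * (X ^ k) powr t * (Y ^ (n - k)) powr t"
        using XY by (auto intro!: mult_mono le simp: pw)
      also have "\<dots> = (real (n choose k) * X ^ k * Y ^ (n - k)) powr t"
        using XY by (simp add: powr_mult)
      also have "real (n choose k) * X ^ k * Y ^ (n - k) \<le> (\<Sum>k\<le>n. real (n choose k) * X ^ k * Y ^ (n - k))"
        using XY that by (intro member_le_sum) auto
      then have "(real (n choose k) * X ^ k * Y ^ (n - k)) powr t \<le> ((X + Y) ^ n) powr t"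
        using XY t by (intro powr_mono2) (auto simp: binomial_ring)
      finally show ?thesis using XY by (simp add: pw)
    qed
    have "a (x + y) ^ n = a ((x + y) ^ n)" using x y subring by (simp add: power is_subringD)
    also have "\<dots> = a (\<Sum>k\<le>n. ?f k)" by (simp add: binomial_ring)
    also have "\<dots> \<le> (\<Sum>k\<le>n. a (?f k))" using fF by (intro sum_le)
    also have "\<dots> \<le> (\<Sum>k\<le>n. ((X + Y) powr t) ^ n)" using summand by (intro sum_mono) auto
    finally show ?thesis by (simp add: algebra_simps)
  qed
  have "a (x + y) \<le> (X + Y) powr t"
    by (rule le_of_power_le_linear_mult_power[OF _ _ pow]) (use nonneg x y subring in \<open>auto simp: is_subringD\<close>)
  then have "a (x + y) powr (1 / t) \<le> ((X + Y) powr t) powr (1 / t)"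
    using nonneg x y subring t by (intro powr_mono2) (auto simp: is_subringD)
  also have "\<dots> = X + Y" using t XY by (simp add: powr_powr)
  finally show ?thesis by (simp add: X_def Y_def)
qed

text \<open>A value at most 1 on the naturals satisfies the hypothesis of
  \<open>triangle_powr\<close> for every positive exponent, in particular for
  \<open>1 / s\<close>.\<close>

lemma triangle_powr_nonarch:
  assumes s: "s > 0" and le: "\<And>n. a (of_nat n) \<le> 1" and x: "x \<in> F" and y: "y \<in> F"
  shows "a (x + y) powr s \<le> a x powr s + a y powr s"
proof -
  have "a (of_nat n) \<le> real n powr (1 / s)" for n
    using le[of n] s by (cases "n = 0") (auto intro: order.trans[OF _ ge_one_powr_ge_zero])
  then show ?thesis using triangle_powr[of "1 / s" x y] s x y by simp
qed

end

section \<open>Absolute values on the rationals\<close>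

lemma rat_abs_value_quotient_of:
  assumes g: "abs_value UNIV (g :: rat \<Rightarrow> real)" 
  shows "g q = g (of_nat (nat \<bar>fst (quotient_of q)\<bar>)) / g (of_nat (nat (snd (quotient_of q))))"
proof -
  interpret abs_value UNIV g by fact
  obtain n d where nd: "quotient_of q = (n, d)" by (cases "quotient_of q")
  have q: "q = of_int n / of_int d" and d: "d > 0" using nd quotient_of_div quotient_of_denom_pos by auto
  have int: "g (of_int k) = g (of_nat (nat \<bar>k\<bar>))" for k
    using uminus[of "of_int k"] by (cases "k \<ge> 0") (auto simp: of_nat_nat)
  have "g q = g (of_int n) / g (of_int d)"
    using mult[of "of_int n" "inverse (of_int d)"] inverse[of "of_int d"] by (simp add: q divide_inverse)
  also have "g (of_int n) = g (of_nat (nat \<bar>n\<bar>))" by (rule int)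
  also have "g (of_int d) = g (of_nat (nat d))" using d by simp
  finally show ?thesis by (simp only: nd prod.sel)
qed

lemma multiplicity_int_nat: "multiplicity (int p) k = multiplicity p (nat \<bar>k\<bar>)"
proof -
  have "int p ^ n dvd k \<longleftrightarrow> p ^ n dvd nat \<bar>k\<bar>" for n
    by (simp add: dvd_nat_abs_iff)
  then show ?thesis unfolding multiplicity_def by simp
qed

text \<open>Multiplicativity reduces everything to \<open>p\<close> and to numbers prime to it. This
  serves Ostrowski's theorem with a general \<open>t\<close> and the extended p-adic value with
  \<open>t = 1\<close>.\<close>

lemma eq_padic_abs_powr:
  assumes g: "abs_value UNIV (g :: rat \<Rightarrow> real)" and p: "prime p"
    and gp: "g (of_nat p) = real p powr (- t)"
    and coprime: "\<And>m. \<not> p dvd m \<Longrightarrow> g (of_nat m) = 1"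
  shows "g q = padic_abs p q powr t"
proof -
  interpret abs_value UNIV g by fact
  have p0: "real p > 0" using prime_gt_0_nat[OF p] by simp
  have nat: "g (of_nat m) = real p powr (- t * multiplicity p m)" if "m > 0" for m
  proof -
    obtain m' where m': "m = p ^ multiplicity p m * m'" "\<not> p dvd m'"
      proof -
      have "m \<noteq> 0" "\<not> is_unit p" using \<open>m > 0\<close> not_prime_unit p by auto
      then show thesis by (rule multiplicity_decompose') (rule that)
    qed
    have "g (of_nat m) = g (of_nat p ^ multiplicity p m * of_nat m')" by (subst m'(1)) simp
    also have "\<dots> = (real p powr (- t)) ^ multiplicity p m"
      using coprime[OF m'(2)] by (simp add: mult power gp)
    finally show ?thesis using p0 by (simp add: powr_realpow[symmetric] powr_powr)
  qed
  show ?thesis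
  proof (cases "q = 0")
    case False
    obtain n d where nd: "quotient_of q = (n, d)" by (cases "quotient_of q")
    have d: "d > 0" using nd quotient_of_denom_pos by auto
    have n: "n \<noteq> 0" using False nd quotient_of_div by fastforce
    have "g q = g (of_nat (nat \<bar>n\<bar>)) / g (of_nat (nat d))"
      using rat_abs_value_quotient_of[OF g, of q] by (simp only: nd prod.sel)
    also have "g (of_nat (nat \<bar>n\<bar>)) = real p powr (- t * multiplicity p (nat \<bar>n\<bar>))"
      using n by (intro nat) simp
    also have "g (of_nat (nat d)) = real p powr (- t * multiplicity p (nat d))"
      using d by (intro nat) simp
    also have "real p powr (- t * multiplicity p (nat \<bar>n\<bar>)) / real p powr (- t * multiplicity p (nat d))
      = real p powr (t * (real (multiplicity p (nat d)) - real (multiplicity p (nat \<bar>n\<bar>))))"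
      by (simp add: powr_diff[symmetric] algebra_simps)
    also have "\<dots> = padic_abs p q powr t"
      using False nd p0 d p by (simp add: padic_abs_def powr_real_of_int'[symmetric] powr_powr multiplicity_int_nat algebra_simps)
    finally show ?thesis .
  qed (simp add: padic_abs_def)
qed

text \<open>Otherwise suitable powers of \<open>m\<close> and \<open>p\<close> both have value below
  1/2, and a Bezout identity between them, with integer coefficients of value at most 1, gives 1 <
  1.\<close>

lemma coprime_abs_eq_1:
  assumes g: "abs_value UNIV (g :: rat \<Rightarrow> real)" and le: "\<And>n. g (of_nat n) \<le> 1"
    and p: "prime p" "g (of_nat p) < 1" and m: "\<not> p dvd m"
  shows "g (of_nat m) = 1"
proof (rule ccontr)
  interpret abs_value UNIV g by fact
  assume "g (of_nat m) \<noteq> 1"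
  then have gm: "g (of_nat m) < 1" using le[of m] by simp
  have lei: "g (of_int k) \<le> 1" for k
    using uminus[of "of_int k"] le[of "nat \<bar>k\<bar>"] by (cases "k \<ge> 0") (auto simp: of_nat_nat)
  obtain k where k1: "g (of_nat m) ^ k < 1/2" and k2: "g (of_nat p) ^ k < 1/2"
  proof -
    obtain i where "g (of_nat m) ^ i < 1/2" using real_arch_pow_inv[of "1/2" "g (of_nat m)"] gm by auto
    moreover obtain j where "g (of_nat p) ^ j < 1/2" using real_arch_pow_inv[of "1/2" "g (of_nat p)"] p by auto
    moreover have "g (of_nat m) ^ max i j \<le> g (of_nat m) ^ i" "g (of_nat p) ^ max i j \<le> g (of_nat p) ^ j"
      using le nonneg by (auto intro!: power_decreasing)
    ultimately show thesis by (intro that[of "max i j"]) auto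
  qed
  have "coprime p m" using p(1) m by (rule prime_imp_coprime)
  then have "coprime (int m ^ k) (int p ^ k)" by (simp add: coprime_commute)
  then obtain u v where "u * int m ^ k + v * int p ^ k = 1"
    using bezout_int[of "int m ^ k" "int p ^ k"] by auto
  then have "(of_int (u * int m ^ k + v * int p ^ k) :: rat) = 1" by simp
  then have eq: "of_int u * of_nat m ^ k + of_int v * of_nat p ^ k = (1 :: rat)" by simp
  have "1 = g (of_int u * of_nat m ^ k + of_int v * of_nat p ^ k)" unfolding eq by simp
  also have "\<dots> \<le> g (of_int u) * g (of_nat m) ^ k + g (of_int v) * g (of_nat p) ^ k"
    using triangle[of "of_int u * of_nat m ^ k" "of_int v * of_nat p ^ k"] by (simp add: mult power)
  also have "\<dots> \<le> 1 * g (of_nat m) ^ k + 1 * g (of_nat p) ^ k"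
    using lei nonneg by (intro add_mono mult_right_mono) auto
  finally show False using k1 k2 by simp
qed

text \<open>Write \<open>N\<close> in base \<open>n\<close>: it has \<open>L + 1\<close> digits, each of absolute value at most \<open>n\<close>.\<close>

lemma abs_value_digits_bound:
  assumes g: "abs_value UNIV (g :: rat \<Rightarrow> real)" and n: "n \<ge> 2" and N: "N < n ^ Suc L"
  shows "g (of_nat N) \<le> real (Suc L) * real n * max 1 (g (of_nat n)) ^ L"
  using N
proof (induction L arbitrary: N)
  interpret abs_value UNIV g by fact
  case 0
  then show ?case using of_nat_le[of N] by simp
next
  interpret abs_value UNIV g by fact
  case (Suc L)
  let ?G = "max 1 (g (of_nat n))"
  have "N div n < n ^ Suc L" using Suc.prems by (auto simp: less_mult_imp_div_less mult.commute)
  then have IH: "g (of_nat (N div n)) \<le> real (Suc L) * real n * ?G ^ L" by (rule Suc.IH)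
  have "g (of_nat N) = g (of_nat n * of_nat (N div n) + of_nat (N mod n))"
    by (metis mult_div_mod_eq of_nat_add of_nat_mult)
  also have "\<dots> \<le> g (of_nat n) * g (of_nat (N div n)) + g (of_nat (N mod n))"
    using triangle[of "of_nat n * of_nat (N div n)" "of_nat (N mod n)"] by (simp add: mult)
  also have "\<dots> \<le> ?G * (real (Suc L) * real n * ?G ^ L) + real n * ?G ^ Suc L"
  proof (intro add_mono mult_mono IH)
    have "g (of_nat (N mod n)) \<le> real n * 1"
    proof -
      have "N mod n \<le> n" using n by (simp add: order.strict_implies_order)
      then have "real (N mod n) \<le> real n" by (rule of_nat_mono)
      then show ?thesis using of_nat_le[of "N mod n"] by simp
    qed
    also have "\<dots> \<le> real n * ?G ^ Suc L" by (intro mult_left_mono one_le_power) auto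
    finally show "g (of_nat (N mod n)) \<le> real n * ?G ^ Suc L" .
  qed (auto simp: nonneg)
  finally show ?case by (simp add: algebra_simps)
qed

text \<open>In base \<open>n\<close> the power \<open>m ^ k\<close> has about
  \<open>k * log n m\<close> digits; the bound for digits is linear in \<open>k\<close> up to a k-th
  power, and the linear factor disappears with \<open>k\<close>. The maximum with 1 covers bases of
  value at most 1.\<close>

lemma abs_value_le_powr_log:
  assumes g: "abs_value UNIV (g :: rat \<Rightarrow> real)" and n: "n \<ge> 2" and m: "m \<ge> 2"
  shows "g (of_nat m) \<le> max 1 (g (of_nat n)) powr (log n m)"
proof -
  interpret abs_value UNIV g by fact
  let ?G = "max 1 (g (of_nat n))"
  define c where "c = log n m"
  have c: "c > 0" using n m by (simp add: c_def)
  have pow: "g (of_nat m) ^ k \<le> ((real n * c) * real k + real n) * (?G powr c) ^ k" for k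
  proof -
    define L where "L = nat \<lfloor>real k * c\<rfloor>"
    have L: "real L \<le> real k * c" "real k * c < real L + 1" using c by (auto simp: L_def)
    have "real m ^ k = real n powr (real k * c)"
      using n m by (simp add: c_def powr_realpow[symmetric] powr_powr[symmetric] mult.commute[of "real k"])
    also have "\<dots> < real n powr (real (Suc L))" using L n by (intro powr_less_mono) auto
    also have "\<dots> = real (n ^ Suc L)" using n by (subst powr_realpow) auto
    finally have "m ^ k < n ^ Suc L" by (metis of_nat_less_iff of_nat_power)
    then have "g (of_nat (m ^ k)) \<le> real (Suc L) * real n * ?G ^ L"
      by (rule abs_value_digits_bound[OF g n])
    also have "?G ^ L = ?G powr real L" by (subst powr_realpow) auto
    also have "real (Suc L) * real n * ?G powr real L \<le> (real k * c + 1) * real n * ?G powr (real k * c)"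
      using L c by (intro mult_mono powr_mono) auto
    also have "?G powr (real k * c) = (?G powr c) ^ k"
      by (simp add: powr_realpow[symmetric] powr_powr mult.commute)
    finally show ?thesis by (simp add: power algebra_simps)
  qed
  show ?thesis unfolding c_def[symmetric]
    by (rule le_of_power_le_linear_mult_power[OF _ _ pow]) (simp_all add: nonneg)
qed

text \<open>If the naturals have values at most 1, some prime has a smaller value and all numbers
  prime to it have value 1. Otherwise comparing two bases in both directions makes
  \<open>ln (g (of_nat n)) / ln n\<close> constant. The final disjunction records the case, because
  it decides how the triangle inequality survives a change of exponent.\<close>

lemma ostrowski:
  assumes g: "abs_value UNIV (g :: rat \<Rightarrow> real)" and nontriv: "\<exists>q. q \<noteq> 0 \<and> g q \<noteq> 1"
  obtains \<phi> t where "\<phi> \<in> usual_abs_values" "t > 0" "\<And>q. g q = \<phi> q powr t"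
    "(\<forall>n. g (of_nat n) \<le> 1) \<or> \<phi> = (\<lambda>q. of_rat \<bar>q\<bar>)"
proof (cases "\<forall>n. g (of_nat n) \<le> 1")
  interpret abs_value UNIV g by fact
  case True
  have "\<exists>p. prime p \<and> g (of_nat p) < 1"
  proof (rule ccontr)
    assume *: "\<nexists>p. prime p \<and> g (of_nat p) < 1"
    then have pr: "g (of_nat p) = 1" if "prime p" for p using True that by (meson linorder_not_less order_antisym)
    have n: "g (of_nat n) = 1" if "n > 0" for n using that
    proof (induction n rule: prime_divisors_induct)
      case (factor p x)
      then show ?case using pr[of p] by (simp add: mult)
    qed auto
    have "g q = 1" if "q \<noteq> 0" for q
    proof -
      obtain n d where nd: "quotient_of q = (n, d)" by (cases "quotient_of q")
      have "d > 0" using nd quotient_of_denom_pos by auto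
      moreover have "n \<noteq> 0" using that nd quotient_of_div by fastforce
      ultimately have "g (of_nat (nat \<bar>n\<bar>)) = 1" "g (of_nat (nat d)) = 1" by (auto intro!: n simp del: of_nat_nat)
      moreover have "g q = g (of_nat (nat \<bar>n\<bar>)) / g (of_nat (nat d))"
        using rat_abs_value_quotient_of[OF g, of q] by (simp only: nd prod.sel)
      ultimately show ?thesis by (simp only: div_by_1)
    qed
    then show False using nontriv by auto
  qed
  then obtain p where p: "prime p" "g (of_nat p) < 1" by auto
  define t where "t = - log p (g (of_nat p))"
  have p1: "real p > 1" using p(1) prime_gt_1_nat by auto
  have gp0: "g (of_nat p) > 0" using nonneg[of "of_nat p"] eq_0_iff[of "of_nat p"] p1 by force
  have gp: "g (of_nat p) = real p powr (- t)" using p1 gp0 by (simp add: t_def)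
  have t: "t > 0" using p(2) p1 gp0 by (simp add: t_def)
  have "g q = padic_abs p q powr t" for q
    by (rule eq_padic_abs_powr[OF g p(1) gp coprime_abs_eq_1[OF g]]) (use True p in auto)
  then show ?thesis using t p(1) True by (intro that[of "padic_abs p" t]) (auto simp: usual_abs_values_def)
next
  interpret abs_value UNIV g by fact
  case False
  then obtain m0 where m0: "g (of_nat m0) > 1" by (auto simp: not_le)
  then have m02: "m0 \<ge> 2" by (cases "m0 = 0 \<or> m0 = 1") auto
  have gt1: "g (of_nat n) > 1" if "n \<ge> 2" for n
  proof (rule ccontr)
    assume "\<not> g (of_nat n) > 1"
    \<comment> \<open>The bound in base \<open>n\<close> would then force the value at
      \<open>m0\<close> down to 1.\<close>
    then have "max 1 (g (of_nat n)) = 1" by simp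
    then show False using abs_value_le_powr_log[OF g that m02] m0 by simp
  qed
  have le: "ln (g (of_nat m)) / ln m \<le> ln (g (of_nat n)) / ln n" if mn: "m \<ge> 2" "n \<ge> 2" for m n
  proof -
    have "ln (g (of_nat m)) \<le> ln (g (of_nat n) powr (log n m))"
      using abs_value_le_powr_log[OF g mn(2,1)] gt1[OF mn(1)] gt1[OF mn(2)]
      by (subst ln_le_cancel_iff) (auto simp: max_def)
    also have "\<dots> = (ln m / ln n) * ln (g (of_nat n))" by (simp add: ln_powr log_def)
    finally show ?thesis using mn by (simp add: field_simps)
  qed
  \<comment> \<open>Every base gives the same quotient by the two-sided comparison; 2 is merely a
    convenient one.\<close>
  define t where "t = ln (g (of_nat 2)) / ln (real 2)"
  have t: "t > 0" using gt1[of 2] by (simp add: t_def)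
  have nat: "g (of_nat m) = real m powr t" for m
  proof (cases "m \<ge> 2")
    case True
    have "ln (g (of_nat m)) / ln m = t" unfolding t_def using le[of m 2] le[of 2 m] True by auto
    then have "ln (g (of_nat m)) = t * ln m" using True by (simp add: field_simps)
    then have "exp (ln (g (of_nat m))) = exp (t * ln m)" by simp
    then show ?thesis using gt1[OF True] True by (simp add: powr_def)
  next
    case False
    then have "m = 0 \<or> m = 1" by auto
    then show ?thesis by auto
  qed
  have "g q = of_rat \<bar>q\<bar> powr t" for q
  proof -
    obtain n d where nd: "quotient_of q = (n, d)" by (cases "quotient_of q")
    have q: "q = of_int n / of_int d" and d: "d > 0" using nd quotient_of_div quotient_of_denom_pos by auto
    have "g q = g (of_nat (nat \<bar>n\<bar>)) / g (of_nat (nat d))"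
      using rat_abs_value_quotient_of[OF g, of q] by (simp only: nd prod.sel)
    also have "\<dots> = (real (nat \<bar>n\<bar>) / real (nat d)) powr t"
      by (simp only: nat powr_divide)
    also have "real (nat \<bar>n\<bar>) / real (nat d) = of_rat \<bar>q\<bar>"
      using d by (simp add: q of_rat_divide abs_divide flip: of_int_abs)
    finally show ?thesis .
  qed
  then show ?thesis using t by (intro that[of "\<lambda>q. of_rat \<bar>q\<bar>" t]) (auto simp: usual_abs_values_def)
qed

section \<open>Normalized absolute values and points\<close>

lemma padic_abs_of_int:
  assumes "c \<noteq> 0"
  shows "padic_abs p (of_int c) = 1 / real p ^ multiplicity (int p) c"
proof -
  have "quotient_of (of_int c) = (c, 1)" 
    using quotient_of_int[of c] by (simp add: Rat.of_int_def)
  then show ?thesis using assms by (simp add: padic_abs_def power_int_minus field_simps)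
qed

lemma padic_abs_nonneg: "padic_abs p q \<ge> 0"
  by (simp add: padic_abs_def)

lemma usual_abs_value_nonneg: "\<phi> \<in> usual_abs_values \<Longrightarrow> \<phi> q \<ge> 0"
  unfolding usual_abs_values_def by (auto simp: padic_abs_nonneg)

text \<open>The power of \<open>p\<close> dividing \<open>c\<close> does not exceed \<open>c\<close>
  in size. This lower bound, the same at all places, controls division by leading
  coefficients.\<close>

lemma usual_abs_value_of_int_ge:
  assumes "\<phi> \<in> usual_abs_values" "c \<noteq> 0"
  shows "1 / real_of_int \<bar>c\<bar> \<le> \<phi> (of_int c)"
  using assms(1) unfolding usual_abs_values_def
proof (elim insertE CollectE exE conjE)
  assume "\<phi> = (\<lambda>q. of_rat \<bar>q\<bar>)"
  moreover have "1 \<le> \<bar>c\<bar>" using assms(2) by simp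
  then have "1 \<le> real_of_int \<bar>c\<bar>" by linarith
  then have "1 / real_of_int \<bar>c\<bar> \<le> 1" by (intro divide_le_eq_1_pos[THEN iffD2]) auto
  with \<open>1 \<le> real_of_int \<bar>c\<bar>\<close> have "1 / real_of_int \<bar>c\<bar> \<le> real_of_int \<bar>c\<bar>" by (rule order.trans[rotated])
  ultimately show ?thesis by (simp flip: of_int_abs)
next
  fix p :: nat assume p: "\<phi> = padic_abs p" "prime p"
  have "int p ^ multiplicity (int p) c dvd c" by (rule multiplicity_dvd)
  then have "int p ^ multiplicity (int p) c \<le> \<bar>c\<bar>" using assms(2)
    by (intro zdvd_imp_le) auto
  then have "real_of_int (int p ^ multiplicity (int p) c) \<le> real_of_int \<bar>c\<bar>" by (simp only: of_int_le_iff)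
  moreover have "real p > 0" using p(2) prime_gt_0_nat by simp
  ultimately show ?thesis using p assms(2) by (simp add: padic_abs_of_int frac_le)
qed

lemma padic_abs_self: "prime p \<Longrightarrow> padic_abs p (of_nat p) = 1 / real p"
  using padic_abs_of_int[of "int p" p] by (simp add: multiplicity_int_nat multiplicity_prime prime_gt_0_nat)

lemma usual_abs_value_nontrivial:
  assumes "\<phi> \<in> usual_abs_values"
  obtains n :: nat where "n > 0" "\<phi> (of_nat n) \<noteq> 1"
  using assms unfolding usual_abs_values_def
proof (elim insertE CollectE exE conjE)
  assume "\<phi> = (\<lambda>q. of_rat \<bar>q\<bar>)"
  then show thesis by (intro that[of 2]) auto
next
  fix p :: nat assume "\<phi> = padic_abs p" "prime p"
  then show thesis using prime_gt_1_nat[of p] by (intro that[of p]) (auto simp: padic_abs_self prime_gt_0_nat)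
qed

text \<open>The archimedean value is recognised at 2, where the p-adic ones are at most 1, and a
  p-adic one at \<open>p\<close>, where no other usual value is below 1. Comparing the values there
  fixes the exponent.\<close>

lemma usual_abs_value_powr_eq:
  assumes "\<phi> \<in> usual_abs_values" "\<psi> \<in> usual_abs_values" and t: "t > 0"
    and eq: "\<And>q. \<phi> q = \<psi> q powr t"
  shows "t = 1"
  using assms(2) unfolding usual_abs_values_def
proof (elim insertE CollectE exE conjE)
  assume \<psi>: "\<psi> = (\<lambda>q. of_rat \<bar>q\<bar>)"
  then have two: "\<phi> 2 = 2 powr t" using eq[of 2] by simp
  then have "\<phi> 2 > 1" using t by simp
  moreover have "padic_abs p 2 \<le> 1" if "prime p" for p
    using padic_abs_of_int[of 2 p] prime_gt_0_nat[OF that] by (simp add: divide_le_eq_1)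
  ultimately have "\<nexists>p. prime p \<and> \<phi> = padic_abs p" using linorder_not_less by blast
  then have "\<phi> = (\<lambda>q. of_rat \<bar>q\<bar>)" using assms(1) unfolding usual_abs_values_def by blast
  then have "2 powr t = (2::real) powr 1" using two by simp
  then show "t = 1" by (subst (asm) powr_inj) auto
next
  fix p :: nat assume p: "\<psi> = padic_abs p" "prime p"
  have p1: "real p > 1" using p(2) prime_gt_1_nat by simp
  have phip: "\<phi> (of_nat p) = real p powr (- t)"
    using eq[of "of_nat p"] p p1 by (simp add: padic_abs_self powr_divide powr_minus field_simps)
  then have lt: "\<phi> (of_nat p) < 1" using p1 t by (simp add: powr_less_one)
  have "\<phi> \<noteq> (\<lambda>q. of_rat \<bar>q\<bar>)" using lt p1 by auto
  then obtain q where q: "\<phi> = padic_abs q" "prime q"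
    using assms(1) unfolding usual_abs_values_def by auto
  have "q = p"
  proof (rule ccontr)
    assume "q \<noteq> p"
    then have "\<not> int q dvd int p" using p(2) q(2) primes_dvd_imp_eq by auto
    then have "padic_abs q (of_nat p) = 1" 
      using padic_abs_of_int[of "int p" q] p1 by (simp add: not_dvd_imp_multiplicity_0)
    then show False using lt q by simp
  qed
  then have "real p powr (- t) = real p powr (- 1)"
    using phip q p1 by (simp add: padic_abs_self powr_minus field_simps)
  then show "t = 1" using p1 by (subst (asm) powr_inj) auto
qed

text \<open>The condition from the body of \<open>place_abs\<close>, isolated so that it also
  applies to absolute values on all algebraic numbers.\<close>

definition normalized :: "(complex \<Rightarrow> real) \<Rightarrow> bool" where
  "normalized a \<longleftrightarrow> (\<exists>\<phi>\<in>usual_abs_values. \<forall>q. a (of_rat q) = \<phi> q)"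

text \<open>Cauchy's bound: for \<open>a x > 1\<close> isolate the leading term, raise all lower
  powers to the exponent \<open>degree p - 1\<close>, and cancel. Only the triangle inequality
  enters, so the bound holds at all places alike.\<close>

lemma (in abs_value) root_bound:
  assumes p: "p \<noteq> 0" "\<And>i. coeff p i \<in> F" and x: "x \<in> F" "poly p x = 0"
  shows "a x \<le> max 1 ((\<Sum>j<degree p. a (coeff p j)) / a (lead_coeff p))"
proof (cases "a x \<le> 1")
  case False
  let ?m = "degree p"
  have lc: "a (lead_coeff p) > 0"
    using eq_0_iff[of "lead_coeff p"] nonneg[of "lead_coeff p"] p by (auto simp: order.order_iff_strict)
  have m: "?m > 0"
  proof (rule ccontr)
    assume "\<not> ?m > 0"
    then obtain c where "p = [:c:]" by (auto elim: degree_eq_zeroE)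
    then show False using p(1) x(2) by simp
  qed
  have "0 = (\<Sum>j<?m. coeff p j * x ^ j) + lead_coeff p * x ^ ?m"
    using x(2) unfolding poly_altdef lessThan_Suc_atMost[symmetric] by simp
  then have eq: "lead_coeff p * x ^ ?m = - (\<Sum>j<?m. coeff p j * x ^ j)"
    by (simp add: add_eq_0_iff2)
  have mem: "coeff p j * x ^ j \<in> F" for j
    using p(2) x(1) subring is_subring_power is_subringD by blast
  have "a (lead_coeff p) * a x ^ ?m = a (lead_coeff p * x ^ ?m)"
    using p(2) x(1) by (simp add: mult power is_subring_power[OF subring])
  also have "\<dots> = a (\<Sum>j<?m. coeff p j * x ^ j)"
    unfolding eq using mem by (intro uminus is_subring_sum[OF subring])
  also have "\<dots> \<le> (\<Sum>j<?m. a (coeff p j * x ^ j))" using mem by (intro sum_le)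
  also have "\<dots> = (\<Sum>j<?m. a (coeff p j) * a x ^ j)"
    using p(2) x(1) by (simp add: mult power is_subring_power[OF subring])
  also have "\<dots> \<le> (\<Sum>j<?m. a (coeff p j) * a x ^ (?m - 1))"
    using False p(2) nonneg by (intro sum_mono mult_left_mono power_increasing) auto
  also have "\<dots> = (\<Sum>j<?m. a (coeff p j)) * a x ^ (?m - 1)" by (simp add: sum_distrib_right)
  finally have "a (lead_coeff p) * a x * a x ^ (?m - 1) \<le> (\<Sum>j<?m. a (coeff p j)) * a x ^ (?m - 1)"
    using m by (cases ?m) (auto simp: mult_ac)
  moreover have "a x ^ (?m - 1) > 0" using False by simp
  ultimately have "a (lead_coeff p) * a x \<le> (\<Sum>j<?m. a (coeff p j))" by simp
  then show ?thesis using lc by (simp add: field_simps le_max_iff_disj)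
qed auto

lemma nontrivial_abs_values_iff:
  assumes "is_subring K"
  shows "a \<in> nontrivial_abs_values K \<longleftrightarrow>
    a \<in> extensional K \<and> abs_value K a \<and> (\<exists>x\<in>K. x \<noteq> 0 \<and> a x \<noteq> 1)"
  unfolding nontrivial_abs_values_def abs_value_def using assms by auto

lemma abs_value_rat:
  assumes "abs_value K (a :: complex \<Rightarrow> real)" "\<And>q. of_rat q \<in> K"
  shows "abs_value UNIV (\<lambda>q. a (of_rat q))"
proof -
  interpret abs_value K a by fact
  show ?thesis
    by standard (use assms(2) in \<open>auto simp: is_subring_def nonneg eq_0_iff mult triangle of_rat_mult of_rat_add\<close>)
qed

text \<open>Were \<open>a\<close> trivial on the rationals, \<open>root_bound\<close> with
  coefficients of value 0 or 1 would bound \<open>a\<close> on \<open>K\<close> by a constant.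
  Applied to powers this gives \<open>a x \<le> 1\<close>, and applied to inverses
  \<open>a x = 1\<close>. Hence Ostrowski's theorem is available below every place.\<close>

lemma number_field_nontrivial_on_rat:
  assumes K: "number_field K" and a: "a \<in> nontrivial_abs_values K"
  obtains q where "q \<noteq> 0" "a (of_rat q) \<noteq> 1"
proof (rule ccontr)
  note KR = number_field_subring[OF K]
  interpret abs_value K a using a KR by (simp add: nontrivial_abs_values_iff)
  assume "\<not> thesis"
  then have triv: "q \<noteq> 0 \<Longrightarrow> a (of_rat q) = 1" for q using that by blast
  obtain d where d: "\<And>x. x \<in> K \<Longrightarrow> \<exists>p. p \<noteq> 0 \<and> degree p \<le> d \<and> (\<forall>i. coeff p i \<in> \<rat>) \<and> poly p x = 0"
    using number_field_degree_bound[OF K] by metis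
  have bound: "a x \<le> real (max 1 d)" if x: "x \<in> K" for x
  proof -
    obtain p where p: "p \<noteq> 0" "degree p \<le> d" "\<And>i. coeff p i \<in> \<rat>" "poly p x = 0"
      using d[OF x] by blast
    have cK: "coeff p i \<in> K" for i using p(3)[of i] number_field_of_rat[OF K] by (auto elim: Rats_cases)
    have c1: "a c \<le> 1" "c \<noteq> 0 \<Longrightarrow> a c = 1" if "c \<in> \<rat>" for c
    proof -
      obtain q where "c = of_rat q" using \<open>c \<in> \<rat>\<close> by (auto elim: Rats_cases)
      then show "a c \<le> 1" "c \<noteq> 0 \<Longrightarrow> a c = 1" using triv[of q] by (cases "q = 0"; auto)+
    qed
    have lc: "a (lead_coeff p) = 1" using p by (intro c1) auto
    have "(\<Sum>j<degree p. a (coeff p j)) \<le> real (card {..<degree p}) * 1"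
      by (rule sum_bounded_above) (use p c1 in auto)
    then have "(\<Sum>j<degree p. a (coeff p j)) / a (lead_coeff p) \<le> real d"
      using p(2) lc by simp
    then show ?thesis using root_bound[OF p(1) cK x p(4)] by simp
  qed
  have le1: "a x \<le> 1" if x: "x \<in> K" for x
  proof (rule le_of_power_le_linear_mult_power)
    show "a x ^ k \<le> (0 * real k + real (max 1 d)) * 1 ^ k" for k
      using bound[OF is_subring_power[OF KR x, of k]] by (simp add: power x)
  qed (use nonneg x in auto)
  obtain x where x: "x \<in> K" "x \<noteq> 0" "a x \<noteq> 1" using a KR by (auto simp: nontrivial_abs_values_iff)
  have "inverse (a x) \<le> 1" 
    using le1[OF number_field_inverse[OF K x(1)]] inverse[OF x(1) number_field_inverse[OF K x(1)]] by simp
  moreover have "a x > 0" using x nonneg[of x] eq_0_iff[of x] by (simp add: order.order_iff_strict)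
  ultimately have "a x \<ge> 1" by (simp add: field_simps)
  then show False using le1 x by force
qed

text \<open>The exponent undoes the one found by Ostrowski's theorem. Only the triangle inequality
  is in doubt after such a change; each case of the theorem has its own lemma for it.\<close>

lemma exists_normalized_powr:
  assumes K: "number_field K" and a: "a \<in> nontrivial_abs_values K"
  obtains t where "t > 0" "(\<lambda>x\<in>K. a x powr t) \<in> nontrivial_abs_values K" "normalized (\<lambda>x\<in>K. a x powr t)"
proof -
  note KR = number_field_subring[OF K]
  note KQ = number_field_of_rat[OF K]
  interpret abs_value K a using a KR by (simp add: nontrivial_abs_values_iff)
  let ?g = "\<lambda>q. a (of_rat q)"
  have g: "abs_value UNIV ?g" using abs_value_rat[OF abs_value_axioms] KQ by blast
  obtain q0 where q0: "q0 \<noteq> 0" "?g q0 \<noteq> 1" using number_field_nontrivial_on_rat[OF K a] .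
  obtain \<phi> t where \<phi>: "\<phi> \<in> usual_abs_values" "t > 0" "\<And>q. ?g q = \<phi> q powr t"
    "(\<forall>n. ?g (of_nat n) \<le> 1) \<or> \<phi> = (\<lambda>q. of_rat \<bar>q\<bar>)"
    using ostrowski[OF g] q0 by blast
  define b where "b = (\<lambda>x\<in>K. a x powr (1 / t))"
  have tri: "a (x + y) powr (1 / t) \<le> a x powr (1 / t) + a y powr (1 / t)" if "x \<in> K" "y \<in> K" for x y
    using \<phi>(4)
  proof
    assume "\<forall>n. ?g (of_nat n) \<le> 1"
    then show ?thesis using \<phi>(2) that by (intro triangle_powr_nonarch) auto
  next
    assume "\<phi> = (\<lambda>q. of_rat \<bar>q\<bar>)"
    then have "a (of_nat n) \<le> real n powr t" for n using \<phi>(3)[of "of_nat n"] by simp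
    then show ?thesis using \<phi>(2) that by (intro triangle_powr)
  qed
  have bQ: "b (of_rat q) = \<phi> q" for q
    using KQ \<phi>(2,3) usual_abs_value_nonneg[OF \<phi>(1)] by (simp add: b_def powr_powr)
  have "abs_value K b"
    using KR tri by unfold_locales (auto simp: b_def eq_0_iff mult nonneg powr_mult is_subringD)
  moreover obtain n where "n > 0" "\<phi> (of_nat n) \<noteq> 1" using usual_abs_value_nontrivial[OF \<phi>(1)] .
  then have "of_nat n \<in> K \<and> of_nat n \<noteq> (0::complex) \<and> b (of_nat n) \<noteq> 1"
    using is_subring_of_nat[OF KR] bQ[of "of_nat n"] by auto
  then have "\<exists>x\<in>K. x \<noteq> 0 \<and> b x \<noteq> 1" by blast
  ultimately have "b \<in> nontrivial_abs_values K"
    unfolding nontrivial_abs_values_iff[OF KR] by (auto simp: b_def)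
  moreover have "normalized b" unfolding normalized_def using \<phi>(1) bQ by auto
  ultimately show ?thesis using that[of "1 / t"] \<phi>(2) by (simp add: b_def)
qed

section \<open>Places and their normalized representatives\<close>

lemma abs_value_equiv_iff:
  "(a, b) \<in> abs_value_equiv K \<longleftrightarrow> a \<in> nontrivial_abs_values K \<and> b \<in> nontrivial_abs_values K \<and>
     (\<exists>t>0. \<forall>x\<in>K. b x = a x powr t)"
  unfolding abs_value_equiv_def by auto

lemma nontrivial_abs_values_nonneg: "a \<in> nontrivial_abs_values K \<Longrightarrow> x \<in> K \<Longrightarrow> a x \<ge> 0"
  unfolding nontrivial_abs_values_def by auto

lemma equiv_abs_value_equiv: "equiv (nontrivial_abs_values K) (abs_value_equiv K)"
proof (rule equivI)
  show "refl_on (nontrivial_abs_values K) (abs_value_equiv K)"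
    by (rule refl_onI)
      (auto simp: abs_value_equiv_iff nontrivial_abs_values_nonneg intro!: exI[of _ "1::real"])
  show "sym (abs_value_equiv K)"
  proof (rule symI)
    fix a b assume "(a, b) \<in> abs_value_equiv K"
    then obtain t where t: "a \<in> nontrivial_abs_values K" "b \<in> nontrivial_abs_values K" "t > 0"
      "\<And>x. x \<in> K \<Longrightarrow> b x = a x powr t" by (auto simp: abs_value_equiv_iff)
    then have "\<forall>x\<in>K. a x = b x powr (1 / t)" by (simp add: powr_powr nontrivial_abs_values_nonneg)
    then show "(b, a) \<in> abs_value_equiv K"
      using t by (auto simp: abs_value_equiv_iff intro!: exI[of _ "1 / t"])
  qed
  show "trans (abs_value_equiv K)"
  proof (rule transI)
    fix a b c assume "(a, b) \<in> abs_value_equiv K" "(b, c) \<in> abs_value_equiv K"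
    then obtain s t where "a \<in> nontrivial_abs_values K" "c \<in> nontrivial_abs_values K" "s > 0" "t > 0"
      "\<And>x. x \<in> K \<Longrightarrow> b x = a x powr s" "\<And>x. x \<in> K \<Longrightarrow> c x = b x powr t"
      by (auto simp: abs_value_equiv_iff)
    then show "(a, c) \<in> abs_value_equiv K"
      by (auto simp: abs_value_equiv_iff powr_powr intro!: exI[of _ "s * t"])
  qed
qed (auto simp: abs_value_equiv_iff)

text \<open>The values on the rationals force the exponent relating \<open>a\<close> and
  \<open>b\<close> to be 1; this is what makes the definite description in \<open>place_abs\<close>
  meaningful.\<close>

lemma normalized_equiv_unique:
  assumes K: "number_field K" and ab: "(a, b) \<in> abs_value_equiv K" and n: "normalized a" "normalized b"
  shows "a = b"
proof -
  obtain t where t: "a \<in> nontrivial_abs_values K" "b \<in> nontrivial_abs_values K" "t > 0"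
    "\<And>x. x \<in> K \<Longrightarrow> b x = a x powr t" using ab by (auto simp: abs_value_equiv_iff)
  obtain \<phi> where \<phi>: "\<phi> \<in> usual_abs_values" "\<And>q. b (of_rat q) = \<phi> q" using n unfolding normalized_def by auto
  obtain \<psi> where \<psi>: "\<psi> \<in> usual_abs_values" "\<And>q. a (of_rat q) = \<psi> q" using n unfolding normalized_def by auto
  have "\<phi> q = \<psi> q powr t" for q using t(4)[OF number_field_of_rat[OF K]] \<phi>(2) \<psi>(2) by simp
  then have "t = 1" using usual_abs_value_powr_eq[OF \<phi>(1) \<psi>(1) t(3)] by blast
  then have "a x = b x" if "x \<in> K" for x using t that by (simp add: nontrivial_abs_values_nonneg)
  moreover have "a \<in> extensional K" "b \<in> extensional K" using t unfolding nontrivial_abs_values_def by auto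
  ultimately show "a = b" by (rule extensionalityI[rotated 2])
qed

lemma place_abs_eqI:
  assumes K: "number_field K" and v: "v \<in> places K" and a: "a \<in> v" "normalized a"
  shows "place_abs v = a"
  unfolding place_abs_def normalized_def[symmetric]
proof (rule the_equality)
  fix b assume b: "b \<in> v \<and> normalized b"
  have "(b, a) \<in> abs_value_equiv K"
    using quotient_eq_iff[OF equiv_abs_value_equiv, of v K v b a] v a b by (simp add: places_def)
  then show "b = a" using normalized_equiv_unique[OF K] a b by blast
qed (use a in auto)

lemma place_abs:
  assumes K: "number_field K" and v: "v \<in> places K"
  shows "place_abs v \<in> v" "normalized (place_abs v)" "place_abs v \<in> nontrivial_abs_values K"
proof -
  obtain a where a: "a \<in> nontrivial_abs_values K" "v = abs_value_equiv K `` {a}"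
    using v unfolding places_def by (rule quotientE)
  obtain t where t: "t > 0" "(\<lambda>x\<in>K. a x powr t) \<in> nontrivial_abs_values K" "normalized (\<lambda>x\<in>K. a x powr t)"
    using exists_normalized_powr[OF K a(1)] .
  have "(\<lambda>x\<in>K. a x powr t) \<in> v" using a t by (auto simp: abs_value_equiv_iff intro!: exI[of _ t])
  then have "place_abs v = (\<lambda>x\<in>K. a x powr t)" using place_abs_eqI[OF K v] t by blast
  then show "place_abs v \<in> v" "normalized (place_abs v)" "place_abs v \<in> nontrivial_abs_values K"
    using \<open>_ \<in> v\<close> t by auto
qed

text \<open>Nontriviality survives restriction because a normalized value is already nontrivial on
  the naturals.\<close>

lemma nontrivial_restrict:
  assumes M: "number_field M" and MF: "M \<subseteq> F" and a: "abs_value F a" "normalized a"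
  shows "restrict a M \<in> nontrivial_abs_values M" "normalized (restrict a M)"
proof -
  interpret abs_value F a by fact
  note MR = number_field_subring[OF M] and MQ = number_field_of_rat[OF M]
  obtain \<phi> where \<phi>: "\<phi> \<in> usual_abs_values" "\<And>q. a (of_rat q) = \<phi> q" using a(2) unfolding normalized_def by auto
  then have rQ: "restrict a M (of_rat q) = \<phi> q" for q using MQ by simp
  have "abs_value M (restrict a M)"
    using MR MF by unfold_locales (auto simp: is_subringD subset_iff nonneg eq_0_iff mult triangle)
  moreover obtain n where "n > 0" "\<phi> (of_nat n) \<noteq> 1" using usual_abs_value_nontrivial[OF \<phi>(1)] .
  then have "of_nat n \<in> M \<and> of_nat n \<noteq> (0::complex) \<and> restrict a M (of_nat n) \<noteq> 1"
    using is_subring_of_nat[OF MR] rQ[of "of_nat n"] by auto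
  then have "\<exists>x\<in>M. x \<noteq> 0 \<and> restrict a M x \<noteq> 1" by blast
  ultimately show "restrict a M \<in> nontrivial_abs_values M"
    unfolding nontrivial_abs_values_iff[OF MR] by auto
  show "normalized (restrict a M)" unfolding normalized_def using \<phi>(1) rQ by auto
qed

section \<open>Points of the inverse limit and absolute values\<close>

lemma topspace_Y_top: "topspace Y_top = compatible_families"
  unfolding Y_top_def compatible_families_def by auto

lemma place_abs_restrict:
  assumes y: "y \<in> topspace Y_top" and M: "number_field M" and K: "number_field K" and "M \<subseteq> K"
  shows "place_abs (y M) = restrict (place_abs (y K)) M"
proof -
  have yP: "y K \<in> places K" "y M \<in> places M" and r: "restrict_place M (y K) = y M"
    using y M K \<open>M \<subseteq> K\<close> unfolding topspace_Y_top compatible_families_def by auto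
  let ?a = "place_abs (y K)"
  have a: "?a \<in> y K" "normalized ?a" "abs_value K ?a"
    using place_abs[OF K yP(1)] nontrivial_abs_values_iff[OF number_field_subring[OF K]] by auto
  note r' = nontrivial_restrict[OF M \<open>M \<subseteq> K\<close> a(3,2)]
  have "restrict ?a M \<in> abs_value_equiv M `` {restrict ?a M}"
    using r'(1) equiv_abs_value_equiv by (rule equiv_class_self[rotated])
  then have "restrict ?a M \<in> y M" using a(1) r unfolding restrict_place_def by blast
  then show ?thesis using place_abs_eqI[OF M yP(2) _ r'(2)] by blast
qed

text \<open>Two fields containing \<open>x\<close> need not be comparable by inclusion; their values
  at \<open>x\<close> agree because both equal the value on the intersection.\<close>

lemma point_abs_eq:
  assumes y: "y \<in> topspace Y_top" and K: "number_field K" and x: "x \<in> K"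
  shows "point_abs y x = place_abs (y K) x"
  unfolding point_abs_def
proof (rule the_equality)
  have yP: "y L \<in> places L" if "number_field L" for L
    using y that unfolding topspace_Y_top compatible_families_def by auto
  show "\<exists>K' v. number_field K' \<and> x \<in> K' \<and> v \<in> places K' \<and> y \<in> Y_over K' v \<and> place_abs (y K) x = place_abs v x"
    using K x y yP by (auto simp: Y_over_def)
  fix r assume "\<exists>K' v. number_field K' \<and> x \<in> K' \<and> v \<in> places K' \<and> y \<in> Y_over K' v \<and> r = place_abs v x"
  then obtain L where L: "number_field L" "x \<in> L" "r = place_abs (y L) x" by (auto simp: Y_over_def)
  have KL: "number_field (K \<inter> L)" by (rule number_field_Int[OF K L(1)])
  have "place_abs (y (K \<inter> L)) x = place_abs (y L) x" "place_abs (y (K \<inter> L)) x = place_abs (y K) x"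
    by (subst place_abs_restrict[OF y KL], use K L x in auto)+
  then show "r = place_abs (y K) x" using L by simp
qed

text \<open>The classes of all restrictions of \<open>A\<close> form a compatible family. This makes
  relations between functions on \<open>Y_top\<close> usable at \<open>A\<close>.\<close>

lemma point_of_abs_value:
  assumes A: "abs_value Qbar A" "normalized A"
  obtains y where "y \<in> topspace Y_top" "\<And>x. algebraic x \<Longrightarrow> point_abs y x = A x"
proof -
  define y where "y = (\<lambda>K\<in>Collect number_field. abs_value_equiv K `` {restrict A K})"
  have sub: "K \<subseteq> Qbar" if "number_field K" for K using number_field_algebraic[OF that] by auto
  note res = nontrivial_restrict[OF _ sub A]
  have yP: "y K \<in> places K" if "number_field K" for K
    using that res unfolding y_def places_def by (auto intro: quotientI)
  have "restrict_place M (y K) = y M" if M: "number_field M" and K: "number_field K" and "M \<subseteq> K" for M K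
  proof -
    \<comment> \<open>\<open>restrict_place\<close> takes a union over the whole class, so an
      arbitrary representative of \<open>y K\<close> has to be restricted, not only
      \<open>A\<close>. It is a power of \<open>A\<close> on \<open>K\<close>, hence still
      nontrivial on \<open>M\<close>.\<close>
    have "abs_value_equiv M `` {restrict a M} = y M" if a: "a \<in> y K" for a
    proof -
      obtain t where t: "t > 0" "\<And>x. x \<in> K \<Longrightarrow> a x = A x powr t" and aK: "a \<in> nontrivial_abs_values K"
        using a K unfolding y_def by (auto simp: abs_value_equiv_iff)
      have MR: "is_subring M" using number_field_subring[OF M] .
      interpret a: abs_value K a using aK number_field_subring[OF K] by (simp add: nontrivial_abs_values_iff)
      have "abs_value M (restrict a M)"
        using MR \<open>M \<subseteq> K\<close> by unfold_locales (auto simp: is_subringD subset_iff a.nonneg a.eq_0_iff a.mult a.triangle)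
      moreover obtain x where x: "x \<in> M" "x \<noteq> 0" "A x \<noteq> 1"
        using res(1)[OF M M] nontrivial_abs_values_iff[OF MR] by auto
      interpret A: abs_value Qbar A by fact
      have "A x > 0" using A.nonneg[of x] A.eq_0_iff[of x] x sub[OF M] by (auto simp: order.order_iff_strict)
      then have "A x powr t \<noteq> 1" using x(3) t(1) by (simp add: powr_eq_one_iff_gen)
      then have "\<exists>x\<in>M. x \<noteq> 0 \<and> restrict a M x \<noteq> 1" using x t(2) \<open>M \<subseteq> K\<close> by (intro bexI[of _ x]) auto
      ultimately have "restrict a M \<in> nontrivial_abs_values M"
        unfolding nontrivial_abs_values_iff[OF MR] by auto
      then have "(restrict A M, restrict a M) \<in> abs_value_equiv M"
        using res(1)[OF M M] t \<open>M \<subseteq> K\<close> by (auto simp: abs_value_equiv_iff intro!: exI[of _ t])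
      then show ?thesis using M equiv_class_eq[OF equiv_abs_value_equiv] unfolding y_def by fastforce
    qed
    moreover have "y K \<noteq> {}" using yP[OF K] in_quotient_imp_non_empty[OF equiv_abs_value_equiv] by (simp add: places_def)
    ultimately show ?thesis unfolding restrict_place_def by auto
  qed
  then have yY: "y \<in> topspace Y_top"
    unfolding topspace_Y_top compatible_families_def using yP by (auto simp: y_def)
  moreover have "point_abs y x = A x" if "algebraic x" for x
  proof -
    obtain K where K: "number_field K" "x \<in> K"
      using number_field_adjoin[OF number_field_Rats \<open>algebraic x\<close>] by metis
    have "restrict A K \<in> y K" using K(1) res(1)[OF K(1) K(1)] equiv_class_self[OF equiv_abs_value_equiv]
      by (auto simp: y_def)
    then have "place_abs (y K) = restrict A K" using place_abs_eqI[OF K(1) yP[OF K(1)]] res(2)[OF K(1) K(1)] by blast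
    then show ?thesis using point_abs_eq[OF yY K] K by simp
  qed
  ultimately show ?thesis using that by blast
qed

section \<open>Embeddings of the field of algebraic numbers\<close>

text \<open>Graphs of ring homomorphisms into \<^typ>\<open>complex\<close> from subrings of the algebraic numbers; working with
  graphs makes Zorn's lemma for set inclusion directly applicable.\<close>

definition hom_graph :: "(complex \<times> complex) set \<Rightarrow> bool" where
  "hom_graph G \<longleftrightarrow> (1, 1) \<in> G \<and>
     (\<forall>x y u w. (x, y) \<in> G \<longrightarrow> (u, w) \<in> G \<longrightarrow> (x + u, y + w) \<in> G \<and> (x * u, y * w) \<in> G) \<and>
     (\<forall>x y. (x, y) \<in> G \<longrightarrow> (- x, - y) \<in> G \<and> algebraic x) \<and>
     (\<forall>y. (0, y) \<in> G \<longrightarrow> y = 0)"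

lemma hom_graphD:
  assumes "hom_graph G"
  shows "(1, 1) \<in> G" "(0, 0) \<in> G" "\<And>x y u w. (x, y) \<in> G \<Longrightarrow> (u, w) \<in> G \<Longrightarrow> (x + u, y + w) \<in> G"
    "\<And>x y u w. (x, y) \<in> G \<Longrightarrow> (u, w) \<in> G \<Longrightarrow> (x * u, y * w) \<in> G"
    "\<And>x y. (x, y) \<in> G \<Longrightarrow> (- x, - y) \<in> G"
    "\<And>x y u w. (x, y) \<in> G \<Longrightarrow> (u, w) \<in> G \<Longrightarrow> (x - u, y - w) \<in> G"
    "\<And>x y. (x, y) \<in> G \<Longrightarrow> algebraic x" "\<And>y. (0, y) \<in> G \<Longrightarrow> y = 0"
proof -
  show one: "(1, 1) \<in> G" and add: "\<And>x y u w. (x, y) \<in> G \<Longrightarrow> (u, w) \<in> G \<Longrightarrow> (x + u, y + w) \<in> G"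
    and "\<And>x y u w. (x, y) \<in> G \<Longrightarrow> (u, w) \<in> G \<Longrightarrow> (x * u, y * w) \<in> G"
    and minus: "\<And>x y. (x, y) \<in> G \<Longrightarrow> (- x, - y) \<in> G"
    and "\<And>x y. (x, y) \<in> G \<Longrightarrow> algebraic x" and "\<And>y. (0, y) \<in> G \<Longrightarrow> y = 0"
    using assms unfolding hom_graph_def by auto
  show "(0, 0) \<in> G" using add[OF one minus[OF one]] by simp
  show "\<And>x y u w. (x, y) \<in> G \<Longrightarrow> (u, w) \<in> G \<Longrightarrow> (x - u, y - w) \<in> G"
    using add[OF _ minus] by (metis add_uminus_conv_diff)
qed

text \<open>Single-valuedness is built into \<open>hom_graph\<close> at 0 only; subtraction spreads
  it.\<close>

lemma hom_graph_fun:
  assumes "hom_graph G" "(x, y) \<in> G" "(x, z) \<in> G"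
  shows "y = z"
  using hom_graphD(8)[OF assms(1), of "y - z"] hom_graphD(6)[OF assms] by simp

lemma hom_graph_of_nat: "hom_graph G \<Longrightarrow> (of_nat n, of_nat n) \<in> G"
  by (induction n) (auto intro: hom_graphD)

lemma hom_graph_of_int: "hom_graph G \<Longrightarrow> (of_int n, of_int n) \<in> G"
  by (cases n) (simp_all only: of_int_of_nat_eq of_int_minus hom_graph_of_nat hom_graphD)

lemma hom_graph_sum:
  "hom_graph G \<Longrightarrow> (\<And>i. i \<in> I \<Longrightarrow> (f i, g i) \<in> G) \<Longrightarrow> (sum f I, sum g I) \<in> G"
  by (induction I rule: infinite_finite_induct) (auto intro: hom_graphD)

text \<open>\<open>q\<close> plays the image of \<open>p\<close> under the homomorphism; as a
  relation it needs no function extracted from the graph.\<close>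

definition poly_pair :: "(complex \<times> complex) set \<Rightarrow> complex poly \<Rightarrow> complex poly \<Rightarrow> bool" where
  "poly_pair G p q \<longleftrightarrow> (\<forall>i. (coeff p i, coeff q i) \<in> G)"

lemma poly_pair_0: "hom_graph G \<Longrightarrow> poly_pair G 0 q \<Longrightarrow> q = 0"
  unfolding poly_pair_def using hom_graphD(8) by (auto intro: poly_eqI)

lemma poly_pair_poly:
  assumes "hom_graph G" "(x, y) \<in> G" "poly_pair G p q"
  shows "(poly p x, poly q y) \<in> G"
  using assms(3)
proof (induction p arbitrary: q)
  case 0
  then have "q = 0" by (rule poly_pair_0[OF assms(1)])
  then show ?case using hom_graphD(2)[OF assms(1)] by simp
next
  case (pCons a p)
  obtain b q' where q: "q = pCons b q'" by (cases q)
  have "(a, b) \<in> G" "poly_pair G p q'"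
    using pCons.prems unfolding poly_pair_def q by (auto dest: spec[of _ 0] spec[of _ "Suc _"])
  then show ?case using pCons.IH[of q'] assms q by (auto intro!: hom_graphD)
qed

text \<open>An integer polynomial with nonzero constant term that kills \<open>x\<close> also kills the image of \<open>x\<close>.\<close>

lemma hom_graph_kernel:
  assumes G: "hom_graph G" and "(x, 0) \<in> G"
  shows "x = 0"
proof (rule ccontr)
  assume "x \<noteq> 0"
  then obtain p where p: "coeff p 0 \<noteq> 0" "poly (map_poly of_int p) x = 0"
    using algebraicE'_nonzero hom_graphD(7)[OF assms] by metis
  have "poly_pair G (map_poly of_int p) (map_poly of_int p)"
    using hom_graph_of_int[OF G] by (auto simp: poly_pair_def coeff_map_poly)
  then have "(0, poly (map_poly of_int p) 0) \<in> G"
    using poly_pair_poly[OF assms] p(2) by force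
  then have "poly (map_poly of_int p) 0 = (0 :: complex)" by (rule hom_graphD(8)[OF G])
  then show False using p(1) by (simp add: poly_0_coeff_0 coeff_map_poly)
qed

text \<open>Extension to quotients. By \<open>hom_graph_kernel\<close> nonzero denominators have
  nonzero images, so sums of fractions match on both sides.\<close>

lemma hom_graph_localise:
  assumes G: "hom_graph G"
  defines "G' \<equiv> {(a / u, b / w) | a b u w. (a, b) \<in> G \<and> (u, w) \<in> G \<and> u \<noteq> 0}"
  shows "hom_graph G'" "G \<subseteq> G'" "\<And>x y. (x, y) \<in> G \<Longrightarrow> x \<noteq> 0 \<Longrightarrow> (inverse x, inverse y) \<in> G'"
proof -
  note GD = hom_graphD[OF G]
  have I: "(a / u, b / w) \<in> G'" if "(a, b) \<in> G" "(u, w) \<in> G" "u \<noteq> 0" for a b u w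
    using that unfolding G'_def by blast
  show "G \<subseteq> G'" using I[OF _ GD(1)] by auto
  show "\<And>x y. (x, y) \<in> G \<Longrightarrow> x \<noteq> 0 \<Longrightarrow> (inverse x, inverse y) \<in> G'"
    using I[OF GD(1)] by (simp add: inverse_eq_divide)
  show "hom_graph G'" unfolding hom_graph_def
  proof (intro conjI allI impI)
    show "(1, 1) \<in> G'" using I[OF GD(1) GD(1)] by simp
    fix x y assume xy: "(x, y) \<in> G'"
    then obtain a b u w where *: "x = a / u" "y = b / w" "(a, b) \<in> G" "(u, w) \<in> G" "u \<noteq> 0"
      unfolding G'_def by blast
    show "(- x, - y) \<in> G'" using I[OF GD(5)[OF *(3)] *(4,5)] * by simp
    have "algebraic a" "algebraic (inverse u)" using GD(7) * by auto
    then show "algebraic x" using is_subringD(4)[OF Qbar_subring] * by (auto simp: divide_inverse)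
    fix x' y' assume "(x', y') \<in> G'"
    then obtain c d v z where **: "x' = c / v" "y' = d / z" "(c, d) \<in> G" "(v, z) \<in> G" "v \<noteq> 0"
      unfolding G'_def by blast
    have nz: "w \<noteq> 0" "z \<noteq> 0" using hom_graph_kernel[OF G] * ** by auto
    have "((a * v + c * u) / (u * v), (b * z + d * w) / (w * z)) \<in> G'"
      by (rule I) (use * ** in \<open>auto intro!: GD\<close>)
    then show "(x + x', y + y') \<in> G'" using * ** nz by (simp add: add_frac_eq)
    have "((a * c) / (u * v), (b * d) / (w * z)) \<in> G'"
      by (rule I) (use * ** in \<open>auto intro!: GD\<close>)
    then show "(x * x', y * y') \<in> G'" using * ** by simp
  next
    fix y assume "(0, y) \<in> G'"
    then obtain a b u w where *: "0 = a / u" "y = b / w" "(a, b) \<in> G" "(u, w) \<in> G" "u \<noteq> 0"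
      unfolding G'_def by blast
    then have "(0, b) \<in> G" by simp
    then show "y = 0" using GD(8) * by simp
  qed
qed

text \<open>Division by the monic \<open>m\<close>, mirrored by \<open>m'\<close> on the image side.
  Each step lowers the degree, and minimality excludes a nonzero remainder, so every relation
  satisfied by \<open>a\<close> passes to \<open>a'\<close>.\<close>

lemma poly_pair_minimal_root:
  assumes G: "hom_graph G" and m: "poly_pair G m m'" "lead_coeff m = 1" "poly m a = 0" "poly m' a' = 0"
    and min: "\<And>p q. poly_pair G p q \<Longrightarrow> p \<noteq> 0 \<Longrightarrow> poly p a = 0 \<Longrightarrow> degree m \<le> degree p"
    and pq: "poly_pair G p q" "poly p a = 0"
  shows "poly q a' = 0"
  using pq
proof (induction "degree p" arbitrary: p q rule: less_induct)
  case less
  note GD = hom_graphD[OF G]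
  show ?case
  proof (cases "p = 0")
    case True
    then have "q = 0" using poly_pair_0[OF G] less.prems(1) by blast
    then show ?thesis by simp
  next
    case False
    define k where "k = degree p - degree m"
    have k: "degree p = k + degree m" using min[OF less.prems(1) False less.prems(2)] by (simp add: k_def)
    define p' where "p' = p - monom (lead_coeff p) k * m"
    \<comment> \<open>Taking the coefficient at \<open>degree p\<close> makes it the partner of
      \<open>lead_coeff p\<close> in \<open>G\<close> without comparing degrees.\<close>
    define q' where "q' = q - monom (coeff q (degree p)) k * m'"
    have "poly_pair G p' q'"
      using less.prems(1) m(1) unfolding poly_pair_def p'_def q'_def
      by (auto simp: coeff_monom_mult intro!: GD)
    moreover have "poly p' a = 0" using less.prems(2) m(3) by (simp add: p'_def)
    moreover have "p' = 0 \<or> degree p' < degree p"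
    proof -
      have "degree (monom (lead_coeff p) k * m) \<le> degree p"
        using degree_mult_le[of "monom (lead_coeff p) k" m] degree_monom_le[of "lead_coeff p" k] k by linarith
      then have "degree p' \<le> degree p" unfolding p'_def by (intro degree_diff_le) auto
      moreover have "coeff p' (degree p) = 0"
        using m(2) by (simp add: p'_def coeff_monom_mult k)
      ultimately show ?thesis using eq_zero_or_degree_less by blast
    qed
    ultimately have "poly q' a' = 0" using less.hyps[of p' q'] poly_pair_0[OF G, of q'] by auto
    then show ?thesis using m(4) by (simp add: q'_def)
  qed
qed

text \<open>The extension sends \<open>poly p a\<close> to \<open>poly q a'\<close>;
  \<open>poly_pair_minimal_root\<close> is exactly its well-definedness.\<close>

lemma hom_graph_adjoin:
  assumes G: "hom_graph G" and m: "poly_pair G m m'" "lead_coeff m = 1" "poly m a = 0" "poly m' a' = 0"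
    and min: "\<And>p q. poly_pair G p q \<Longrightarrow> p \<noteq> 0 \<Longrightarrow> poly p a = 0 \<Longrightarrow> degree m \<le> degree p"
    and a: "algebraic a"
  obtains G' where "hom_graph G'" "G \<subseteq> G'" "(a, a') \<in> G'"
proof -
  note GD = hom_graphD[OF G]
  define G' where "G' = {(poly p a, poly q a') | p q. poly_pair G p q}"
  have I: "(poly p a, poly q a') \<in> G'" if "poly_pair G p q" for p q using that unfolding G'_def by blast
  have const: "poly_pair G [:x:] [:y:]" if "(x, y) \<in> G" for x y
    using that GD(2) by (auto simp: poly_pair_def coeff_pCons split: nat.split)
  have "hom_graph G'" unfolding hom_graph_def
  proof (intro conjI allI impI)
    show "(1, 1) \<in> G'" using I[OF const[OF GD(1)]] by simp
    fix x y assume "(x, y) \<in> G'"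
    then obtain p q where *: "x = poly p a" "y = poly q a'" "poly_pair G p q" unfolding G'_def by blast
    have "poly_pair G (- p) (- q)" using * by (auto simp: poly_pair_def intro: GD)
    then show "(- x, - y) \<in> G'" using I * by force
    have "poly p a \<in> Qbar"
      using * a GD(7) by (intro is_subring_poly[OF Qbar_subring]) (auto simp: poly_pair_def)
    then show "algebraic x" using * by simp
    fix x' y' assume "(x', y') \<in> G'"
    then obtain r s where **: "x' = poly r a" "y' = poly s a'" "poly_pair G r s" unfolding G'_def by blast
    have "poly_pair G (p + r) (q + s)" using * ** by (auto simp: poly_pair_def intro: GD)
    then show "(x + x', y + y') \<in> G'" using I * ** by force
    have "poly_pair G (p * r) (q * s)"
      using * ** by (auto simp: poly_pair_def coeff_mult intro!: GD hom_graph_sum[OF G])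
    then show "(x * x', y * y') \<in> G'" using I * ** by force
  next
    fix y assume "(0, y) \<in> G'"
    then obtain p q where "poly p a = 0" "y = poly q a'" "poly_pair G p q" unfolding G'_def by auto
    then show "y = 0" using poly_pair_minimal_root[OF G m min] by simp
  qed
  moreover have "G \<subseteq> G'" using I[OF const] by auto
  moreover have "poly_pair G [:0, 1:] [:0, 1:]"
    using GD(1,2) by (auto simp: poly_pair_def coeff_pCons split: nat.split)
  then have "(a, a') \<in> G'" using I by force
  ultimately show ?thesis using that by blast
qed

text \<open>Closure under inverses allows a polynomial of least degree with root \<open>a\<close> to
  be made monic. Its image keeps a coefficient 1 in positive degree, so it has a complex root, the
  image chosen for \<open>a\<close>.\<close>

lemma hom_graph_extend:
  assumes G: "hom_graph G" and inv: "\<And>x y. (x, y) \<in> G \<Longrightarrow> x \<noteq> 0 \<Longrightarrow> (inverse x, inverse y) \<in> G"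
    and a: "algebraic a"
  obtains G' a' where "hom_graph G'" "G \<subseteq> G'" "(a, a') \<in> G'"
proof -
  note GD = hom_graphD[OF G]
  define P where "P = (\<lambda>(p, q). poly_pair G p q \<and> p \<noteq> 0 \<and> poly p a = 0)"
  obtain p0 where p0: "\<And>i. coeff p0 i \<in> \<int>" "p0 \<noteq> 0" "poly p0 a = 0" using a unfolding algebraic_def by blast
  have "(coeff p0 i, coeff p0 i) \<in> G" for i
    using p0(1)[of i] hom_graph_of_int[OF G] by (auto elim!: Ints_cases)
  then have "P (p0, p0)" using p0 by (simp add: P_def poly_pair_def)
  then obtain z where z: "P z" "\<And>y. P y \<Longrightarrow> degree (fst z) \<le> degree (fst y)"
    using ex_has_least_nat[of P "(p0, p0)" "\<lambda>z. degree (fst z)"] by blast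
  obtain p q where zpq: "z = (p, q)" by (cases z)
  have pq: "P (p, q)" using z(1) zpq by simp
  have min: "degree p \<le> degree r" if "poly_pair G r s" "r \<noteq> 0" "poly r a = 0" for r s
    using z(2)[of "(r, s)"] that zpq by (simp add: P_def)
  define m where "m = smult (inverse (lead_coeff p)) p"
  define m' where "m' = smult (inverse (coeff q (degree p))) q"
  have p: "poly_pair G p q" "p \<noteq> 0" "poly p a = 0" using pq by (auto simp: P_def)
  then have "(inverse (lead_coeff p), inverse (coeff q (degree p))) \<in> G"
    by (intro inv) (auto simp: poly_pair_def)
  then have pair: "poly_pair G m m'" using p(1) by (auto simp: m_def m'_def poly_pair_def intro!: GD)
  have lc: "lead_coeff m = 1" and ma: "poly m a = 0" and dm: "degree m = degree p"
    using p by (auto simp: m_def)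
  have "degree m > 0"
  proof (rule ccontr)
    assume "\<not> degree m > 0"
    then obtain c where "m = [:c:]" by (auto elim: degree_eq_zeroE)
    then show False using lc ma by simp
  qed
  moreover have "(1, coeff m' (degree m)) \<in> G" using pair lc unfolding poly_pair_def by metis
  then have "coeff m' (degree m) = 1" using hom_graph_fun[OF G _ GD(1)] by blast
  then have "degree m' \<ge> degree m" by (intro le_degree) simp
  ultimately have "\<not> constant (poly m')" by (simp add: constant_degree)
  then obtain a' where "poly m' a' = 0" using fundamental_theorem_of_algebra by blast
  then obtain G' where "hom_graph G'" "G \<subseteq> G'" "(a, a') \<in> G'"
    by (rule hom_graph_adjoin[OF G pair lc ma _ _ a]) (auto simp: dm intro: min)
  then show ?thesis by (rule that)
qed

text \<open>A graph maximal by Zorn's lemma equals its own localisation, hence is closed under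
  inverses; \<open>hom_graph_extend\<close> then shows that nothing is left to adjoin.\<close>

lemma hom_graph_total_extension:
  assumes G0: "hom_graph G0"
  obtains G where "hom_graph G" "G0 \<subseteq> G" "\<And>a. algebraic a \<Longrightarrow> \<exists>a'. (a, a') \<in> G"
proof -
  have "\<exists>M\<in>{G. hom_graph G \<and> G0 \<subseteq> G}. \<forall>X\<in>{G. hom_graph G \<and> G0 \<subseteq> G}. M \<subseteq> X \<longrightarrow> X = M"
  proof (rule subset_Zorn_nonempty)
    fix C assume C: "C \<noteq> {}" "subset.chain {G. hom_graph G \<and> G0 \<subseteq> G} C"
    have hg: "hom_graph X" "G0 \<subseteq> X" if "X \<in> C" for X using C(2) that unfolding subset_chain_def by auto
    have two: "\<exists>X\<in>C. s \<in> X \<and> t \<in> X" if st: "s \<in> \<Union>C" "t \<in> \<Union>C" for s t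
    proof -
      obtain X Y where "X \<in> C" "s \<in> X" "Y \<in> C" "t \<in> Y" using st by auto
      moreover then have "X \<subseteq> Y \<or> Y \<subseteq> X" using C(2) unfolding subset_chain_def by blast
      ultimately show ?thesis by blast
    qed
    have "hom_graph (\<Union>C)" unfolding hom_graph_def
    proof (intro conjI allI impI)
      show "(1, 1) \<in> \<Union>C" using C(1) hom_graphD(1)[OF hg(1)] by blast
      fix x y assume xy: "(x, y) \<in> \<Union>C"
      then show "(- x, - y) \<in> \<Union>C" "algebraic x" using hom_graphD(5,7)[OF hg(1)] by blast+
      fix u w assume "(u, w) \<in> \<Union>C"
      then obtain X where "X \<in> C" "(x, y) \<in> X" "(u, w) \<in> X" using two xy by blast
      then show "(x + u, y + w) \<in> \<Union>C" "(x * u, y * w) \<in> \<Union>C" using hom_graphD(3,4)[OF hg(1)] by blast+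
    next
      fix y assume "(0, y) \<in> \<Union>C"
      then show "y = 0" using hom_graphD(8)[OF hg(1)] by blast
    qed
    then show "\<Union>C \<in> {G. hom_graph G \<and> G0 \<subseteq> G}" using C(1) hg(2) by blast
  qed (use G0 in auto)
  then obtain G where G: "hom_graph G" "G0 \<subseteq> G" and max: "\<And>X. hom_graph X \<Longrightarrow> G \<subseteq> X \<Longrightarrow> X = G"
    by auto
  have inv: "(inverse x, inverse y) \<in> G" if "(x, y) \<in> G" "x \<noteq> 0" for x y
    using hom_graph_localise(3)[OF G(1) that] max[OF hom_graph_localise(1,2)[OF G(1)]] by simp
  have "\<exists>a'. (a, a') \<in> G" if "algebraic a" for a
  proof -
    obtain G' a' where "hom_graph G'" "G \<subseteq> G'" "(a, a') \<in> G'"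
      by (rule hom_graph_extend[OF G(1) inv \<open>algebraic a\<close>])
    then show ?thesis using max by blast
  qed
  then show ?thesis using that G by blast
qed

text \<open>The identity of the rationals extends by sending \<open>b\<close> to \<open>b'\<close>,
  both being roots of the minimal polynomial \<open>m\<close>, and then to all algebraic numbers.
  Outside these \<sigma> is arbitrary, hence the restricted laws.\<close>

lemma conjugate_embedding:
  fixes b b' :: complex
  assumes m: "lead_coeff m = 1" "\<And>i. coeff m i \<in> \<rat>" "poly m b = 0" "poly m b' = 0"
    and min: "\<And>p. (\<And>i. coeff p i \<in> \<rat>) \<Longrightarrow> p \<noteq> 0 \<Longrightarrow> poly p b = 0 \<Longrightarrow> degree m \<le> degree p"
  obtains \<sigma> where "\<sigma> b = b'" "\<And>x y. algebraic x \<Longrightarrow> algebraic y \<Longrightarrow> \<sigma> (x + y) = \<sigma> x + \<sigma> y"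
    "\<And>x y. algebraic x \<Longrightarrow> algebraic y \<Longrightarrow> \<sigma> (x * y) = \<sigma> x * \<sigma> y"
    "\<And>x. algebraic x \<Longrightarrow> algebraic (\<sigma> x)" "\<And>x. algebraic x \<Longrightarrow> \<sigma> x = 0 \<longleftrightarrow> x = 0"
    "\<And>q. \<sigma> (of_rat q) = of_rat q"
proof -
  define G0 where "G0 = (\<lambda>x. (x, x)) ` (\<rat> :: complex set)"
  have G0: "hom_graph G0" by (auto simp: hom_graph_def G0_def rat_imp_algebraic)
  have pair: "poly_pair G0 p q \<longleftrightarrow> q = p \<and> (\<forall>i. coeff p i \<in> \<rat>)" for p q
    by (auto simp: poly_pair_def G0_def image_iff poly_eq_iff)
  have "m \<noteq> 0" using m(1) by auto
  then have b: "algebraic b" using m(2,3) algebraicI' by blast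
  obtain G1 where G1: "hom_graph G1" "G0 \<subseteq> G1" "(b, b') \<in> G1"
    by (rule hom_graph_adjoin[OF G0 _ m(1,3,4) _ b]) (use m(2) min pair in auto)
  obtain G where G: "hom_graph G" "G1 \<subseteq> G" "\<And>a. algebraic a \<Longrightarrow> \<exists>a'. (a, a') \<in> G"
    by (rule hom_graph_total_extension[OF G1(1)]) blast
  note GD = hom_graphD[OF G(1)]
  define \<sigma> where "\<sigma> = (\<lambda>x. THE y. (x, y) \<in> G)"
  have eq: "\<sigma> x = y" if "(x, y) \<in> G" for x y
    unfolding \<sigma>_def using that hom_graph_fun[OF G(1)] by blast
  have mem: "(x, \<sigma> x) \<in> G" if "algebraic x" for x using G(3)[OF that] eq by blast
  have rat: "(of_rat q, of_rat q) \<in> G" for q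
    using G1(2) G(2) Rats_of_rat[of q] unfolding G0_def by blast
  have alg: "algebraic (\<sigma> x)" if "algebraic x" for x
  proof -
    obtain p where p: "\<And>i. coeff p i \<in> \<int>" "p \<noteq> 0" "poly p x = 0" using \<open>algebraic x\<close> unfolding algebraic_def by blast
    have "(coeff p i, coeff p i) \<in> G" for i
      using p(1)[of i] hom_graph_of_int[OF G(1)] by (auto elim!: Ints_cases)
    then have "poly_pair G p p" by (simp add: poly_pair_def)
    from poly_pair_poly[OF G(1) mem[OF that] this] have "poly p (\<sigma> x) = 0"
      unfolding p(3) by (rule GD(8))
    then show ?thesis using p by (intro algebraicI[of p]) auto
  qed
  show ?thesis
  proof (rule that)
    show "\<sigma> b = b'" using eq G1(3) G(2) by blast
    fix x y :: complex assume x: "algebraic x" and y: "algebraic y"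
    show "\<sigma> (x + y) = \<sigma> x + \<sigma> y" "\<sigma> (x * y) = \<sigma> x * \<sigma> y"
      using GD(3,4)[OF mem[OF x] mem[OF y]] eq by blast+
  next
    fix x :: complex assume x: "algebraic x"
    show "algebraic (\<sigma> x)" by (rule alg[OF x])
    show "\<sigma> x = 0 \<longleftrightarrow> x = 0"
      using mem[OF x] GD(8)[of "\<sigma> x"] hom_graph_kernel[OF G(1), of x] by auto
  next
    fix q show "\<sigma> (of_rat q) = of_rat q" using eq rat by blast
  qed
qed

section \<open>Extension of the p-adic absolute value\<close>

text \<open>Chevalley's construction: a subring of the algebraic numbers that is maximal among those without \<open>1 / p\<close>
  is a valuation ring, and its valuation extends the \<open>p\<close>-adic one.\<close>

locale maximal_subring =
  fixes p :: nat and R :: "complex set"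
  assumes p: "prime p" and R: "is_subring R" and RQ: "R \<subseteq> Qbar" and pR: "1 / of_nat p \<notin> R"
    and max: "\<And>S. is_subring S \<Longrightarrow> S \<subseteq> Qbar \<Longrightarrow> R \<subseteq> S \<Longrightarrow> 1 / of_nat p \<notin> S \<Longrightarrow> S = R"
begin

abbreviation P :: complex where "P \<equiv> of_nat p"

lemma P0: "P \<noteq> 0" using prime_gt_0_nat[OF p] by simp

lemma PR: "P \<in> R" by (rule is_subring_of_nat[OF R])

lemmas Radd = is_subringD(3)[OF R] and Rmult = is_subringD(4)[OF R] and Rpow = is_subring_power[OF R]

lemmas RD = is_subringD[OF R] is_subring_power[OF R] is_subring_sum[OF R]

text \<open>The ring generated by \<open>R\<close> and \<open>x\<close> is strictly larger than
  \<open>R\<close>, so maximality puts \<open>1 / P\<close> into it.\<close>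

lemma adjoin:
  assumes x: "algebraic x" "x \<notin> R"
  obtains q where "\<And>i. coeff q i \<in> R" "poly q x = 1 / P"
proof -
  define S where "S = {poly q x | q. \<forall>i. coeff q i \<in> R}"
  have I: "poly q x \<in> S" if "\<And>i. coeff q i \<in> R" for q using that unfolding S_def by blast
  have const: "c \<in> S" if "c \<in> R" for c
    using I[of "[:c:]"] that RD(1) by (simp add: coeff_pCons split: nat.split)
  have "is_subring S" unfolding is_subring_def
  proof (intro conjI ballI)
    fix y assume "y \<in> S"
    then obtain q where q: "y = poly q x" "\<forall>i. coeff q i \<in> R" unfolding S_def by blast
    show "- y \<in> S" using I[of "- q"] q RD by simp
    fix z assume "z \<in> S"
    then obtain r where r: "z = poly r x" "\<forall>i. coeff r i \<in> R" unfolding S_def by blast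
    show "y + z \<in> S" using I[of "q + r"] q r RD by simp
    have "coeff (q * r) i \<in> R" for i unfolding coeff_mult using q r by (auto intro!: RD)
    then show "y * z \<in> S" using I[of "q * r"] q r by simp
  qed (use const RD in auto)
  moreover have "S \<subseteq> Qbar"
    unfolding S_def using RQ x(1) by (auto intro!: is_subring_poly[OF Qbar_subring, simplified])
  moreover have "R \<subseteq> S" using const by blast
  moreover have "x \<in> S" using I[of "[:0, 1:]"] RD by (simp add: coeff_pCons split: nat.split)
  ultimately have "1 / P \<in> S" using max x(2) by blast
  then obtain q where "1 / P = poly q x" "\<forall>i. coeff q i \<in> R" unfolding S_def by blast
  then show ?thesis by (intro that[of q]) auto
qed

text \<open>Adjoining the inverse of \<open>u\<close> expresses \<open>1 / P\<close> as a polynomial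
  in it; a power of \<open>u\<close> clears the denominators. So \<open>P\<close> divides a power of
  every nonunit.\<close>

lemma nonunit_power:
  assumes u: "u \<in> R" "u \<noteq> 0" "inverse u \<notin> R"
  obtains n where "u ^ n / P \<in> R"
proof -
  have "algebraic (inverse u)" using RQ u by auto
  then obtain q where q: "\<And>i. coeff q i \<in> R" "poly q (inverse u) = 1 / P" using adjoin u(3) by metis
  have "u ^ degree q / P = poly q (inverse u) * u ^ degree q" by (simp add: q(2))
  also have "\<dots> = (\<Sum>i\<le>degree q. coeff q i * (inverse u ^ i * u ^ degree q))"
    unfolding poly_altdef sum_distrib_right by (simp add: mult.assoc)
  also have "\<dots> = (\<Sum>i\<le>degree q. coeff q i * u ^ (degree q - i))"
    using u(2) by (intro sum.cong) (auto simp: power_diff power_inverse field_simps)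
  also have "\<dots> \<in> R" using q(1) u(1) by (intro RD)
  finally show ?thesis by (rule that)
qed

text \<open>Powers of \<open>1 - P * b\<close> stay congruent to 1 modulo \<open>P\<close>, whereas
  \<open>P\<close> would divide a power of a nonunit.\<close>

lemma inverse_one_minus:
  assumes b: "b \<in> R"
  shows "1 - P * b \<noteq> 0" "inverse (1 - P * b) \<in> R"
proof -
  let ?u = "1 - P * b"
  show nz: "?u \<noteq> 0"
  proof
    assume "?u = 0"
    then have "b = 1 / P" using P0 by (simp add: field_simps)
    then show False using pR b by simp
  qed
  have uR: "?u \<in> R" using b PR RD by auto
  show "inverse ?u \<in> R"
  proof (rule ccontr)
    assume "inverse ?u \<notin> R"
    then obtain n where n: "?u ^ n / P \<in> R" using nonunit_power[OF uR nz] by blast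
    have "\<exists>c\<in>R. ?u ^ n = 1 - P * c" for n
    proof (induction n)
      case 0 then show ?case using RD(1) by (intro bexI[of _ 0]) auto
    next
      case (Suc n)
      then obtain c where c: "c \<in> R" "?u ^ n = 1 - P * c" by blast
      have "?u ^ Suc n = (1 - P * c) * ?u" using c(2) by simp
      also have "\<dots> = 1 - P * (c + b * (1 - P * c))" by (simp add: algebra_simps)
      finally show ?case using c(1) b PR RD by (intro bexI[of _ "c + b * (1 - P * c)"]) auto
    qed
    then obtain c where c: "c \<in> R" "?u ^ n = 1 - P * c" by blast
    have "1 / P = ?u ^ n / P + c" unfolding c(2) using P0 by (simp add: field_simps)
    then show False using n c(1) RD pR by auto
  qed
qed

text \<open>If \<open>P\<close> divided a power of \<open>m\<close>, a Bezout identity between that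
  power and \<open>p\<close> would put \<open>1 / P\<close> into \<open>R\<close>. These units make
  the value on the rationals p-adic.\<close>

lemma inverse_coprime:
  assumes m: "\<not> p dvd m"
  shows "inverse (of_nat m) \<in> R"
proof (rule ccontr)
  assume "inverse (of_nat m) \<notin> R"
  moreover have "m \<noteq> 0" using m by (cases "m = 0") auto
  then have "of_nat m \<noteq> (0::complex)" by simp
  ultimately obtain n where n: "of_nat m ^ n / P \<in> R" using nonunit_power is_subring_of_nat[OF R] by blast
  have "coprime p m" using p m by (rule prime_imp_coprime)
  then have "coprime (int m ^ n) (int p)" by (simp add: coprime_commute)
  then obtain u v where "u * int m ^ n + v * int p = 1" using bezout_int[of "int m ^ n" "int p"] by auto
  then have "(of_int (u * int m ^ n + v * int p) :: complex) = 1" by simp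
  then have "of_int u * of_nat m ^ n + of_int v * P = 1" by simp
  then have "1 / P = of_int u * (of_nat m ^ n / P) + of_int v" using P0 by (simp add: field_simps)
  also have "\<dots> \<in> R" by (intro Radd Rmult n is_subring_of_int[OF R])
  finally show False using pR by contradiction
qed

text \<open>The relation for \<open>inverse x\<close> expresses \<open>x ^ n\<close>, \<open>n = degree f\<close>, through lower powers of \<open>x\<close>, because
  \<open>1 - P * coeff g 0\<close> is a unit; this lowers the degree of \<open>f\<close>.\<close>

lemma valuation_aux:
  assumes x: "x \<noteq> 0" and f: "\<And>i. coeff f i \<in> R" "poly f x = 1 / P"
    and g: "\<And>i. coeff g i \<in> R" "poly g (inverse x) = 1 / P"
    and le: "degree g \<le> degree f"
    and min: "\<And>h. (\<And>i. coeff h i \<in> R) \<Longrightarrow> poly h x = 1 / P \<Longrightarrow> degree f \<le> degree h"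
  shows False
proof -
  define n where "n = degree f"
  define m where "m = degree g"
  have m: "m > 0"
  proof (rule ccontr)
    assume "\<not> m > 0"
    then obtain c where "g = [:c:]" unfolding m_def by (auto elim: degree_eq_zeroE)
    then show False using g pR by (metis coeff_pCons_0 poly_pCons mult_zero_right add.right_neutral poly_0)
  qed
  have mn: "m \<le> n" using le by (simp add: n_def m_def)
  let ?u = "1 - P * coeff g 0"
  have u: "?u \<noteq> 0" "inverse ?u \<in> R" using inverse_one_minus[OF g(1)] by auto
  have "1 = P * poly g (inverse x)" using g(2) P0 by simp
  also have "poly g (inverse x) = coeff g 0 + (\<Sum>j\<in>{1..m}. coeff g j * inverse x ^ j)"
    unfolding poly_altdef m_def[symmetric] by (subst sum.atMost_shift) (simp add: sum.atLeast1_atMost_eq lessThan_Suc_atMost)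
  finally have "?u = P * (\<Sum>j\<in>{1..m}. coeff g j * inverse x ^ j)" by (simp add: algebra_simps)
  \<comment> \<open>The factor \<open>x ^ n\<close> turns inverse powers into powers of
    \<open>x\<close> with exponents from \<open>n - m\<close> to \<open>n - 1\<close>.\<close>
  then have "x ^ n * ?u = P * (\<Sum>j\<in>{1..m}. coeff g j * (inverse x ^ j * x ^ n))"
    by (simp add: sum_distrib_left mult_ac)
  also have "(\<Sum>j\<in>{1..m}. coeff g j * (inverse x ^ j * x ^ n)) = (\<Sum>j\<in>{1..m}. coeff g j * x ^ (n - j))"
    using x mn by (intro sum.cong) (auto simp: power_diff power_inverse field_simps)
  finally have "x ^ n = inverse ?u * (P * (\<Sum>j\<in>{1..m}. coeff g j * x ^ (n - j)))"
    using u(1) by (simp add: field_simps)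
  also have "\<dots> = (\<Sum>j\<in>{1..m}. (inverse ?u * P * coeff g j) * x ^ (n - j))"
    by (simp add: sum_distrib_left mult_ac)
  finally have xn: "x ^ n = (\<Sum>j\<in>{1..m}. (inverse ?u * P * coeff g j) * x ^ (n - j))" .
  define h where "h = (\<Sum>j\<in>{1..m}. monom (inverse ?u * P * coeff g j) (n - j))"
  have ph: "poly h x = x ^ n" unfolding h_def by (simp add: xn poly_sum poly_monom)
  have hR: "coeff h i \<in> R" for i
    unfolding h_def coeff_sum using u(2) PR g(1) RD by (auto intro!: RD simp del: inverse_eq_divide)
  have dh: "coeff h i = 0" if "i \<ge> n" for i
    unfolding h_def coeff_sum using that m mn by (intro sum.neutral) auto
  \<comment> \<open>The leading term of \<open>f\<close> is traded for lower powers with the same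
    value at \<open>x\<close>.\<close>
  define f' where "f' = f - monom (lead_coeff f) n + smult (lead_coeff f) h"
  have "coeff f' i \<in> R" for i using f(1) hR RD by (auto simp: f'_def)
  moreover have "poly f' x = 1 / P" by (simp add: f'_def ph f(2) poly_monom)
  ultimately have "n \<le> degree f'" unfolding n_def by (rule min)
  moreover have "coeff f' i = 0" if "i \<ge> n" for i
    using that dh[OF that] by (cases "i = n") (auto simp: f'_def n_def coeff_eq_0)
  then have "degree f' < n" using m mn by (intro degree_lessI) auto
  ultimately show False by simp
qed

text \<open>If both \<open>x\<close> and its inverse were missing, each would give a polynomial
  expression for \<open>1 / P\<close>. With both of least degree, \<open>valuation_aux\<close>
  contradicts the minimality of one of larger degree; the two cases exchange \<open>x\<close> with
  its inverse.\<close>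

lemma valuation:
  assumes x: "algebraic x" "x \<noteq> 0" "x \<notin> R"
  shows "inverse x \<in> R"
proof (rule ccontr)
  assume ix: "inverse x \<notin> R"
  have ex: "\<exists>f. ((\<forall>i. coeff f i \<in> R) \<and> poly f y = 1 / P) \<and>
      (\<forall>h. (\<forall>i. coeff h i \<in> R) \<and> poly h y = 1 / P \<longrightarrow> degree f \<le> degree h)" if y: "algebraic y" "y \<notin> R" for y
  proof -
    obtain q where "(\<forall>i. coeff q i \<in> R) \<and> poly q y = 1 / P" using adjoin[OF y] by blast
    then show ?thesis by (rule ex_has_least_nat)
  qed
  obtain f where f: "\<And>i. coeff f i \<in> R" "poly f x = 1 / P"
    "\<And>h. (\<And>i. coeff h i \<in> R) \<Longrightarrow> poly h x = 1 / P \<Longrightarrow> degree f \<le> degree h"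
    using ex[OF x(1,3)] by blast
  obtain g where g: "\<And>i. coeff g i \<in> R" "poly g (inverse x) = 1 / P"
    "\<And>h. (\<And>i. coeff h i \<in> R) \<Longrightarrow> poly h (inverse x) = 1 / P \<Longrightarrow> degree g \<le> degree h"
    using ex[of "inverse x"] x(1) ix by blast
  show False
  proof (cases "degree g \<le> degree f")
    case True
    show ?thesis by (rule valuation_aux[OF x(2) f(1,2) g(1,2) True f(3)])
  next
    case False
    show ?thesis
      by (rule valuation_aux[of "inverse x" g f, OF _ g(1,2) f(1) _ _ g(3)]) (use False x(2) f(2) in auto)
  qed
qed

text \<open>Only the p-part of the denominator has to be cleared, the rest being invertible in
  \<open>R\<close>.\<close>

lemma of_rat_clear:
  obtains k where "P ^ k * of_rat q \<in> R"
proof -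
  obtain a b where ab: "quotient_of q = (a, b)" by (cases "quotient_of q")
  have q: "q = of_int a / of_int b" and b: "b > 0" using ab quotient_of_div quotient_of_denom_pos by auto
  have "nat b \<noteq> 0" "\<not> is_unit p" using b not_prime_unit p by auto
  then obtain w where w: "nat b = p ^ multiplicity p (nat b) * w" "\<not> p dvd w" by (rule multiplicity_decompose')
  let ?k = "multiplicity p (nat b)"
  have w0: "w \<noteq> 0" using w(2) by (cases w) auto
  have "(of_int b :: complex) = of_nat (nat b)" using b by simp
  also have "\<dots> = P ^ ?k * of_nat w" by (subst w(1)) simp
  finally have "P ^ ?k * of_rat q = of_int a * inverse (of_nat w)"
    using P0 w0 by (simp add: q of_rat_divide field_simps)
  also have "\<dots> \<in> R" using inverse_coprime[OF w(2)] is_subring_of_int[OF R] Rmult by blast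
  finally show ?thesis by (rule that)
qed

text \<open>For suitable \<open>k\<close> the number \<open>z = P ^ k * x\<close> is integral over
  \<open>R\<close>, and valuation rings are integrally closed: if \<open>z\<close> were missing, its
  inverse would be in \<open>R\<close>, and the monic relation divided by \<open>z ^ (m - 1)\<close>
  would express \<open>z\<close> in \<open>R\<close>.\<close>

lemma clear_denominator:
  assumes x: "algebraic x"
  obtains k where "P ^ k * x \<in> R"
proof (cases "x = 0")
  case True
  then show ?thesis using that[of 0] RD by simp
next
  case False
  obtain m q where m: "m > 0" "x ^ m = (\<Sum>j<m. of_rat (q j) * x ^ j)" using monic_rat_poly[OF x] .
  have "\<forall>j. \<exists>k. P ^ k * of_rat (q j) \<in> R" using of_rat_clear by metis
  then obtain kk where kk: "\<And>j. P ^ kk j * of_rat (q j) \<in> R" by metis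
  define k where "k = (\<Sum>j<m. kk j)"
  have kR: "P ^ k * of_rat (q j) \<in> R" if "j < m" for j
  proof -
    have "kk j \<le> k" unfolding k_def using that by (intro member_le_sum) auto
    then have "P ^ k = P ^ (k - kk j) * P ^ kk j" by (simp flip: power_add)
    then have "P ^ k * of_rat (q j) = P ^ (k - kk j) * (P ^ kk j * of_rat (q j))" by (simp only: mult.assoc)
    then show ?thesis using kk PR RD by metis
  qed
  define z where "z = P ^ k * x"
  have z0: "z \<noteq> 0" using False P0 by (simp add: z_def)
  have zalg: "algebraic z" unfolding z_def
    using is_subringD(4)[OF Qbar_subring] RQ PR RD(7) x by (metis mem_Collect_eq subsetD)
  have "z \<in> R"
  proof (rule ccontr)
    assume nz: "z \<notin> R"
    have y: "inverse z \<in> R" using valuation[OF zalg z0 nz] .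
    have "z ^ m = P ^ (k * m) * x ^ m" by (simp add: z_def power_mult_distrib power_mult)
    also have "\<dots> = (\<Sum>j<m. P ^ (k * m) * (of_rat (q j) * x ^ j))" unfolding m(2) by (rule sum_distrib_left)
    also have "\<dots> = (\<Sum>j<m. P ^ (k * (m - 1 - j)) * (P ^ k * of_rat (q j)) * z ^ j)"
    proof (rule sum.cong)
      fix j assume "j \<in> {..<m}"
      then obtain i where "m = Suc (j + i)" using less_imp_Suc_add by blast
      \<comment> \<open>\<open>P ^ k\<close> clears the coefficient \<open>q j\<close>,
        \<open>P ^ (k * j)\<close> turns \<open>x ^ j\<close> into \<open>z ^ j\<close>, and the
        remaining power lies in \<open>R\<close>.\<close>
      then have "k * m = k * (m - 1 - j) + k + k * j" by (simp add: algebra_simps)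
      then show "P ^ (k * m) * (of_rat (q j) * x ^ j) = P ^ (k * (m - 1 - j)) * (P ^ k * of_rat (q j)) * z ^ j"
        by (simp add: z_def power_add power_mult_distrib power_mult)
    qed simp
    finally have "z ^ m * inverse z ^ (m - 1)
        = (\<Sum>j<m. P ^ (k * (m - 1 - j)) * (P ^ k * of_rat (q j)) * (z ^ j * inverse z ^ (m - 1)))"
      by (simp add: sum_distrib_right mult.assoc)
    also have "\<dots> = (\<Sum>j<m. P ^ (k * (m - 1 - j)) * (P ^ k * of_rat (q j)) * inverse z ^ (m - 1 - j))"
    proof (rule sum.cong)
      fix j assume "j \<in> {..<m}"
      then have "m - 1 = j + (m - 1 - j)" by simp
      then have "inverse z ^ (m - 1) = inverse z ^ j * inverse z ^ (m - 1 - j)" by (metis power_add)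
      then have "z ^ j * inverse z ^ (m - 1) = inverse z ^ (m - 1 - j)"
        using z0 by (simp add: power_inverse)
      then show "P ^ (k * (m - 1 - j)) * (P ^ k * of_rat (q j)) * (z ^ j * inverse z ^ (m - 1))
        = P ^ (k * (m - 1 - j)) * (P ^ k * of_rat (q j)) * inverse z ^ (m - 1 - j)" by simp
    qed simp
    also have "\<dots> \<in> R" by (intro is_subring_sum[OF R] Rmult[OF Rmult] Rpow PR y kR) auto
    also have "z ^ m * inverse z ^ (m - 1) = z" using z0 m(1) by (cases m) (auto simp: power_inverse)
    finally show False using nz by simp
  qed
  then show ?thesis using that z_def by blast
qed

lemma P_powi_mem_iff: "P powi a \<in> R \<longleftrightarrow> a \<ge> 0"
proof
  assume "P powi a \<in> R"
  show "a \<ge> 0"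
  proof (rule ccontr)
    assume "\<not> a \<ge> 0"
    then have "P powi a * P ^ nat (- a - 1) = P powi (a + (- a - 1))"
      using P0 by (subst power_int_add) (auto simp: power_int_def)
    also have "\<dots> = 1 / P" by (simp add: power_int_minus field_simps)
    finally show False using \<open>P powi a \<in> R\<close> pR PR RD by metis
  qed
qed (auto simp: power_int_def intro: RD PR)

text \<open>The value group is not discrete, so the valuation is read off from the rationals \<open>a / b\<close> with \<open>p ^ a\<close> dividing \<open>x ^ b\<close>.\<close>

definition slopes :: "complex \<Rightarrow> real set" where
  "slopes x = {real_of_int a / real b | a b. b > 0 \<and> x ^ b * P powi (- a) \<in> R}"

text \<open>Meaningful for nonzero algebraic \<open>x\<close>; at 0 the slopes are unbounded, so
  \<open>extended_abs\<close> treats 0 apart.\<close>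

definition val :: "complex \<Rightarrow> real" where
  "val x = Sup (slopes x)"

lemma slopesI: "b > 0 \<Longrightarrow> x ^ b * P powi (- a) \<in> R \<Longrightarrow> real_of_int a / real b \<in> slopes x"
  unfolding slopes_def by blast

lemma slopes_nonempty: "algebraic x \<Longrightarrow> slopes x \<noteq> {}"
proof -
  assume "algebraic x"
  then obtain k where "P ^ k * x \<in> R" by (rule clear_denominator)
  then have *: "x ^ 1 * P powi (- (- int k)) \<in> R" by (simp add: mult.commute)
  have "real_of_int (- int k) / real 1 \<in> slopes x" by (rule slopesI[OF _ *]) simp
  then show ?thesis by blast
qed

text \<open>An exponent clearing the denominator of the inverse of \<open>x\<close> bounds all
  slopes, as no negative power of \<open>P\<close> lies in \<open>R\<close>.\<close>

lemma slopes_bdd_above: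
  assumes "algebraic x" "x \<noteq> 0"
  shows "bdd_above (slopes x)"
proof -
  obtain k where k: "P ^ k * inverse x \<in> R" using clear_denominator algebraic_inverse[OF assms(1)] by blast
  have "l \<le> real k" if l: "l \<in> slopes x" for l
  proof -
    obtain a b where ab: "l = real_of_int a / real b" "b > 0" "x ^ b * P powi (- a) \<in> R"
      using l unfolding slopes_def by blast
    have "(P ^ k * inverse x) ^ b * (x ^ b * P powi (- a)) \<in> R" by (rule Rmult[OF Rpow[OF k] ab(3)])
    also have "(P ^ k * inverse x) ^ b * (x ^ b * P powi (- a)) = P ^ (k * b) * P powi (- a)"
      using assms(2) by (simp add: power_mult_distrib power_inverse power_mult)
    also have "\<dots> = P powi (int (k * b) + (- a))" 
      using P0 by (subst power_int_add) (auto simp del: of_nat_mult)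
    finally have "a \<le> int (k * b)" unfolding P_powi_mem_iff by simp
    then have "real_of_int a \<le> real_of_int (int (k * b))" by (simp only: of_int_le_iff)
    then show ?thesis using ab by (simp add: divide_le_eq)
  qed
  then show ?thesis by (rule bdd_aboveI)
qed

lemma val_upper: "algebraic x \<Longrightarrow> x \<noteq> 0 \<Longrightarrow> l \<in> slopes x \<Longrightarrow> l \<le> val x"
  unfolding val_def by (intro cSup_upper slopes_bdd_above)

lemma val_nonneg: "x \<in> R \<Longrightarrow> x \<noteq> 0 \<Longrightarrow> val x \<ge> 0"
  using val_upper[of x 0] slopesI[of 1 x 0] RQ by auto

lemma val_P_powi: "val (P powi c) = real_of_int c"
  unfolding val_def
proof (rule cSup_eq_maximum)
  have "(P powi c) ^ 1 * P powi (- c) = 1" using P0 by (simp flip: power_int_add)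
  then show "real_of_int c \<in> slopes (P powi c)" using slopesI[of 1 "P powi c" c] RD by simp
  fix l assume "l \<in> slopes (P powi c)"
  then obtain a b where ab: "l = real_of_int a / real b" "b > 0" "(P powi c) ^ b * P powi (- a) \<in> R"
    unfolding slopes_def by blast
  have "(P powi c) ^ b * P powi (- a) = P powi (c * int b + (- a))"
    using P0 by (subst power_int_add) (auto simp: power_int_mult)
  then have "a \<le> c * int b" using ab P_powi_mem_iff by simp
  then have "real_of_int a \<le> real_of_int (c * int b)" by (simp only: of_int_le_iff)
  then show "l \<le> real_of_int c" using ab by (simp add: divide_le_eq)
qed

lemma val_1: "val 1 = 0"
  using val_P_powi[of 0] by simp

text \<open>Slopes add: raising the memberships to the powers \<open>d\<close> and \<open>b\<close>
  produces the common denominator \<open>b * d\<close>. The suprema are then taken one at a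
  time.\<close>

lemma val_mult_ge:
  assumes x: "algebraic x" "x \<noteq> 0" and y: "algebraic y" "y \<noteq> 0"
  shows "val x + val y \<le> val (x * y)"
proof -
  have xy: "algebraic (x * y)" "x * y \<noteq> 0" using is_subringD(4)[OF Qbar_subring] x y by auto
  have *: "l + l' \<le> val (x * y)" if l: "l \<in> slopes x" and l': "l' \<in> slopes y" for l l'
  proof -
    obtain a b where ab: "l = real_of_int a / real b" "b > 0" "x ^ b * P powi (- a) \<in> R"
      using l unfolding slopes_def by blast
    obtain c d where cd: "l' = real_of_int c / real d" "d > 0" "y ^ d * P powi (- c) \<in> R"
      using l' unfolding slopes_def by blast
    have pw: "(P powi e) ^ j = P powi (e * int j)" for e j by (simp add: power_int_mult)
    have "(x ^ b * P powi (- a)) ^ d * (y ^ d * P powi (- c)) ^ b \<in> R"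
      by (rule Rmult[OF Rpow[OF ab(3)] Rpow[OF cd(3)]])
    also have "(x ^ b * P powi (- a)) ^ d * (y ^ d * P powi (- c)) ^ b
        = (x * y) ^ (b * d) * (P powi (- a * int d) * P powi (- c * int b))"
      by (simp only: power_mult_distrib pw power_mult[symmetric] mult_ac)
    also have "P powi (- a * int d) * P powi (- c * int b) = P powi (- (a * int d + c * int b))"
      using P0 by (simp flip: power_int_add)
    finally have "real_of_int (a * int d + c * int b) / real (b * d) \<in> slopes (x * y)"
      using ab cd by (intro slopesI) auto
    also have "real_of_int (a * int d + c * int b) / real (b * d) = l + l'"
      using ab cd by (simp add: field_simps)
    finally show ?thesis using val_upper[OF xy] by blast
  qed
  have "val x \<le> val (x * y) - l'" if "l' \<in> slopes y" for l'
    unfolding val_def[of x] using slopes_nonempty[OF x(1)] *[OF _ that] by (intro cSup_least) (auto simp: algebra_simps)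
  then have "val y \<le> val (x * y) - val x"
    unfolding val_def[of y] using slopes_nonempty[OF y(1)] by (intro cSup_least) (auto simp: algebra_simps)
  then show ?thesis by simp
qed

text \<open>A rational \<open>r\<close> just above \<open>val x\<close> is no slope, so the
  corresponding quotient is not in \<open>R\<close>. By \<open>valuation\<close> its inverse is,
  which makes \<open>- r\<close> a slope of the inverse of \<open>x\<close>.\<close>

lemma val_inverse_ge:
  assumes x: "algebraic x" "x \<noteq> 0"
  shows "- val x \<le> val (inverse x)"
proof (rule field_le_epsilon)
  fix e :: real assume "e > 0"
  then obtain r where r: "r \<in> \<rat>" "val x < r" "r < val x + e" using Rats_dense_in_real[of "val x" "val x + e"] by auto
  obtain a b' where b': "b' > 0" "r = of_int a / of_nat b'"
  proof -
    obtain q where q: "r = of_rat q" using r(1) by (auto elim: Rats_cases)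
    obtain a b where ab: "quotient_of q = (a, b)" by (cases "quotient_of q")
    have "q = of_int a / of_int b" "b > 0" using ab quotient_of_div quotient_of_denom_pos by auto
    then show thesis using q by (intro that[of "nat b" a]) (auto simp: of_rat_divide)
  qed
  have "x ^ b' * P powi (- a) \<notin> R"
    using val_upper[OF x] slopesI[OF b'(1), of x a] r(2) b'(2) by force
  moreover have "algebraic (x ^ b' * P powi (- a))"
  proof -
    have "P powi (- a) \<in> Qbar" using RQ PR by (auto simp: power_int_def intro!: is_subring_power[OF Qbar_subring, simplified])
    then show ?thesis using is_subringD(4)[OF Qbar_subring] is_subring_power[OF Qbar_subring] x by simp
  qed
  moreover have "x ^ b' * P powi (- a) \<noteq> 0" using x P0 by simp
  ultimately have "inverse (x ^ b' * P powi (- a)) \<in> R" using valuation by blast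
  also have "inverse (x ^ b' * P powi (- a)) = inverse x ^ b' * P powi (- (- a))"
    by (simp add: power_inverse power_int_minus)
  finally have "real_of_int (- a) / real b' \<in> slopes (inverse x)" using b' by (intro slopesI)
  then have "real_of_int (- a) / real b' \<le> val (inverse x)" using val_upper[of "inverse x"] x(2) algebraic_inverse[OF x(1)] by simp
  then show "- val x \<le> val (inverse x) + e" using r b' by simp
qed

text \<open>The reverse inequality is superadditivity applied to \<open>x * y\<close> and the
  inverse of \<open>y\<close>.\<close>

lemma val_mult:
  assumes x: "algebraic x" "x \<noteq> 0" and y: "algebraic y" "y \<noteq> 0"
  shows "val (x * y) = val x + val y"
proof (rule antisym)
  have xy: "algebraic (x * y)" "x * y \<noteq> 0" using is_subringD(4)[OF Qbar_subring] x y by auto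
  have "val (x * y) + val (inverse y) \<le> val (x * y * inverse y)"
    using xy y by (intro val_mult_ge algebraic_inverse) auto
  also have "x * y * inverse y = x" using y by simp
  finally show "val (x * y) \<le> val x + val y" using val_inverse_ge[OF y] by simp
qed (rule val_mult_ge[OF x y])

lemma val_unit:
  assumes "x \<in> R" "inverse x \<in> R" "x \<noteq> 0"
  shows "val x = 0"
proof -
  have "algebraic x" "algebraic (inverse x)" using RQ assms by auto
  then have "val x + val (inverse x) = 0" using val_mult[of x "inverse x"] assms val_1 by simp
  then show ?thesis using val_nonneg[of x] val_nonneg[of "inverse x"] assms by simp
qed

text \<open>One of the two quotients of \<open>x\<close> and \<open>y\<close> lies in
  \<open>R\<close>. Factoring out its denominator leaves 1 plus an element of \<open>R\<close>, of
  nonnegative valuation.\<close>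

lemma val_add:
  assumes x: "algebraic x" "x \<noteq> 0" and y: "algebraic y" "y \<noteq> 0" and "x + y \<noteq> 0"
  shows "val (x + y) \<ge> min (val x) (val y)"
proof -
  have *: "val (x + y) \<ge> val y" if "x * inverse y \<in> R" "algebraic y" "y \<noteq> 0" "x + y \<noteq> 0" for x y
  proof -
    have "x + y = y * (1 + x * inverse y)" using that by (simp add: field_simps)
    moreover have "1 + x * inverse y \<in> R" using that(1) Radd RD(2) by blast
    moreover have "1 + x * inverse y \<noteq> 0" using calculation(1) that(4) by force
    moreover have "algebraic (1 + x * inverse y)" using calculation(2) RQ by auto
    ultimately show ?thesis using val_mult[of y "1 + x * inverse y"] val_nonneg[of "1 + x * inverse y"] that by simp
  qed
  have "algebraic (x * inverse y)" using is_subringD(4)[OF Qbar_subring] x(1) algebraic_inverse[OF y(1)] by simp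
  then have "x * inverse y \<in> R \<or> inverse (x * inverse y) \<in> R" using valuation[of "x * inverse y"] x y by auto
  moreover have "inverse (x * inverse y) = y * inverse x" by (simp add: mult.commute)
  ultimately have "x * inverse y \<in> R \<or> y * inverse x \<in> R" by metis
  then show ?thesis using *[of x y] *[of y x] x y assms(5) by (auto simp: add.commute min_le_iff_disj)
qed

definition extended_abs :: "complex \<Rightarrow> real" where
  "extended_abs x = (if x = 0 then 0 else real p powr (- val x))"

lemma extended_abs: 
  "abs_value Qbar extended_abs" "extended_abs (of_rat q) = padic_abs p q"
proof -
  have p1: "real p > 1" using prime_gt_1_nat[OF p] by simp
  show A: "abs_value Qbar extended_abs"
  proof
    fix x y :: complex assume x: "x \<in> Qbar" and y: "y \<in> Qbar"
    show "extended_abs x \<ge> 0" "extended_abs x = 0 \<longleftrightarrow> x = 0" using p1 by (auto simp: extended_abs_def)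
    show "extended_abs (x * y) = extended_abs x * extended_abs y"
      using x y by (auto simp: extended_abs_def val_mult simp flip: powr_add)
    show "extended_abs (x + y) \<le> extended_abs x + extended_abs y"
    proof (cases "x = 0 \<or> y = 0 \<or> x + y = 0")
      case False
      then have "val (x + y) \<ge> min (val x) (val y)" using val_add x y by simp
      then have "extended_abs (x + y) \<le> max (extended_abs x) (extended_abs y)"
        using False p1 by (auto simp: extended_abs_def min_def le_max_iff_disj split: if_splits)
      moreover have "extended_abs z \<ge> 0" for z by (simp add: extended_abs_def)
      ultimately show ?thesis by (smt (verit))
    qed (auto simp: extended_abs_def)
  qed (rule Qbar_subring)
  have "abs_value UNIV (\<lambda>q. extended_abs (of_rat q))"
  proof -
    interpret abs_value Qbar extended_abs by (rule A)
    show ?thesis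
      by standard (auto simp: is_subring_def nonneg eq_0_iff mult triangle of_rat_mult of_rat_add rat_imp_algebraic)
  qed
  then have "extended_abs (of_rat q) = padic_abs p q powr 1"
  proof (rule eq_padic_abs_powr[OF _ p])
    show "extended_abs (of_rat (of_nat p)) = real p powr - 1"
      using val_P_powi[of 1] P0 by (simp add: extended_abs_def)
    fix m assume m: "\<not> p dvd m"
    then have "m \<noteq> 0" by (cases m) auto
    then have "val (of_nat m) = 0" using inverse_coprime[OF m] is_subring_of_nat[OF R] by (intro val_unit) auto
    then show "extended_abs (of_rat (of_nat m)) = 1" using \<open>m \<noteq> 0\<close> p1 by (simp add: extended_abs_def)
  qed
  then show "extended_abs (of_rat q) = padic_abs p q" by (simp add: padic_abs_def)
qed

end

text \<open>Zorn's lemma, with the integers as a first ring without \<open>1 / p\<close>.\<close>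

lemma exists_maximal_subring:
  assumes p: "prime (p::nat)"
  obtains R where "maximal_subring p R"
proof -
  let ?A = "{R. is_subring R \<and> R \<subseteq> Qbar \<and> 1 / of_nat p \<notin> R}"
  have "\<exists>M\<in>?A. \<forall>X\<in>?A. M \<subseteq> X \<longrightarrow> X = M"
  proof (rule subset_Zorn_nonempty)
    have "1 / of_nat p \<notin> (\<int> :: complex set)"
    proof
      assume "1 / of_nat p \<in> (\<int> :: complex set)"
      then obtain k where k: "1 / of_nat p = (of_int k :: complex)" by (auto elim: Ints_cases)
      have "of_int (k * int p) = (1 :: complex)" using k prime_gt_0_nat[OF p] by (simp add: field_simps)
      then have "k * int p = 1" by (metis of_int_1 of_int_eq_iff)
      then show False using p by (metis dvd_triv_right int_dvd_int_iff not_prime_unit of_nat_1)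
    qed
    moreover have "is_subring (\<int> :: complex set)" by (auto simp: is_subring_def)
    moreover have "\<int> \<subseteq> Qbar" by (auto elim: Ints_cases)
    ultimately show "?A \<noteq> {}" by blast
    fix C assume C: "C \<noteq> {}" "subset.chain ?A C"
    have hg: "is_subring X" "X \<subseteq> Qbar" "1 / of_nat p \<notin> X" if "X \<in> C" for X
      using C(2) that unfolding subset_chain_def by auto
    have two: "\<exists>X\<in>C. s \<in> X \<and> t \<in> X" if st: "s \<in> \<Union>C" "t \<in> \<Union>C" for s t
    proof -
      obtain X Y where "X \<in> C" "s \<in> X" "Y \<in> C" "t \<in> Y" using st by auto
      moreover then have "X \<subseteq> Y \<or> Y \<subseteq> X" using C(2) unfolding subset_chain_def by blast
      ultimately show ?thesis by blast
    qed
    have "is_subring (\<Union>C)" unfolding is_subring_def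
    proof (intro conjI ballI)
      show "0 \<in> \<Union>C" "1 \<in> \<Union>C" using C(1) is_subringD(1,2)[OF hg(1)] by blast+
      fix x assume x: "x \<in> \<Union>C"
      then show "- x \<in> \<Union>C" using is_subringD(5)[OF hg(1)] by blast
      fix y assume "y \<in> \<Union>C"
      then obtain X where "X \<in> C" "x \<in> X" "y \<in> X" using two x by blast
      then show "x + y \<in> \<Union>C" "x * y \<in> \<Union>C" using is_subringD(3,4)[OF hg(1)] by blast+
    qed
    then show "\<Union>C \<in> ?A" using C(1) hg(2,3) by blast
  qed
  then obtain M where "M \<in> ?A" "\<forall>X\<in>?A. M \<subseteq> X \<longrightarrow> X = M" by blast
  then have "maximal_subring p M" using p by unfold_locales auto
  then show ?thesis by (rule that)
qed

lemma exists_extension_usual_abs_value: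
  assumes "\<phi> \<in> usual_abs_values"
  obtains A where "abs_value Qbar A" "\<And>q. A (of_rat q) = \<phi> q"
  using assms unfolding usual_abs_values_def
proof (elim insertE CollectE exE conjE)
  assume \<phi>: "\<phi> = (\<lambda>q. of_rat \<bar>q\<bar>)"
  have "norm (of_rat q :: complex) = of_rat \<bar>q\<bar>" for q
  proof -
    obtain a b where "quotient_of q = (a, b)" by (cases "quotient_of q")
    then have q: "q = of_int a / of_int b" by (rule quotient_of_div)
    have "norm (of_rat q :: complex) = \<bar>of_rat q\<bar>" by (simp add: q of_rat_divide norm_divide)
    also have "\<dots> = of_rat \<bar>q\<bar>" by (simp add: q of_rat_divide flip: of_int_abs)
    finally show ?thesis .
  qed
  moreover have "abs_value Qbar (norm :: complex \<Rightarrow> real)"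
    by standard (auto simp: Qbar_subring norm_mult norm_triangle_ineq)
  ultimately show thesis using that[of norm] \<phi> by simp
next
  fix p assume \<phi>: "\<phi> = padic_abs p" and "prime p"
  obtain R where "maximal_subring p R" using exists_maximal_subring[OF \<open>prime p\<close>] .
  then interpret maximal_subring p R .
  show thesis using that[of extended_abs] extended_abs \<phi> by simp
qed

section \<open>Finiteness and the main theorem\<close>

text \<open>A prime power exactly dividing the denominator is the p-adic value of \<open>q\<close>,
  hence at most \<open>B\<close>, and so divides the least common multiple \<open>L\<close> of the
  integers up to \<open>B\<close>. All denominators divide \<open>L\<close>, and the archimedean
  bound limits the numerators.\<close>

lemma finite_rat_bounded_at_all_places: "finite {q. \<forall>\<phi>\<in>usual_abs_values. \<phi> q \<le> B}" (is "finite ?S")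
proof -
  define L where "L = Lcm {1..nat \<lfloor>B\<rfloor>}"
  have L0: "L \<noteq> 0" unfolding L_def by (subst Lcm_0_iff) auto
  define M where "M = \<lceil>\<bar>B\<bar> * real L\<rceil>"
  have "q \<in> (\<lambda>a. of_int a / of_nat L) ` {- M..M}" if q: "q \<in> ?S" for q
  proof -
    obtain n d where nd: "quotient_of q = (n, d)" by (cases "quotient_of q")
    have qnd: "q = of_int n / of_int d" and d: "d > 0" and cop: "coprime n d"
      using nd quotient_of_div quotient_of_denom_pos quotient_of_coprime by auto
    have "nat d dvd L"
    proof (rule multiplicity_le_imp_dvd)
      fix p :: nat assume p: "prime p"
      show "multiplicity p (nat d) \<le> multiplicity p L"
      proof (cases "p dvd nat d")
        case True
        then have "int p dvd d" using d by (metis int_dvd_int_iff int_nat_eq less_imp_le)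
        then have "\<not> int p dvd n" using cop p
          by (metis coprime_common_divisor not_prime_unit prime_nat_int_transfer)
        then have mn: "multiplicity (int p) n = 0" by (rule not_dvd_imp_multiplicity_0)
        have md: "multiplicity (int p) d = multiplicity p (nat d)" using d by (simp add: multiplicity_int_nat)
        have "q \<noteq> 0"
        proof
          assume "q = 0"
          then have "n = 0" using qnd d by simp
          then show False using \<open>\<not> int p dvd n\<close> by simp
        qed
        then have "padic_abs p q = real p ^ multiplicity p (nat d)"
          using nd mn md by (simp add: padic_abs_def)
        moreover have "padic_abs p q \<le> B" using q p by (auto simp: usual_abs_values_def)
        ultimately have "real (p ^ multiplicity p (nat d)) \<le> B" by simp
        then have "p ^ multiplicity p (nat d) \<le> nat \<lfloor>B\<rfloor>" by (rule le_nat_floor)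
        moreover have "p ^ multiplicity p (nat d) \<ge> 1" using prime_gt_0_nat[OF p] by simp
        ultimately have "p ^ multiplicity p (nat d) dvd L" unfolding L_def by (intro dvd_Lcm) auto
        then show ?thesis using L0 not_prime_unit p by (intro multiplicity_geI) auto
      qed (simp add: not_dvd_imp_multiplicity_0)
    qed (use d in auto)
    then obtain c where c: "L = nat d * c" by (rule dvdE)
    have "q = of_int (n * int c) / of_nat L"
      using d L0 unfolding qnd c by (auto simp: field_simps)
    moreover have "\<bar>real_of_int (n * int c)\<bar> \<le> \<bar>B\<bar> * real L"
    proof -
      have "of_rat \<bar>q\<bar> \<le> B" using q by (auto simp: usual_abs_values_def)
      then have "of_rat \<bar>q\<bar> \<le> \<bar>B\<bar>" by simp
      moreover have "\<bar>q\<bar> = of_int \<bar>n * int c\<bar> / of_nat L"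
        unfolding \<open>q = of_int (n * int c) / of_nat L\<close> by (simp only: abs_divide of_int_abs abs_of_nat)
      then have "real_of_rat \<bar>q\<bar> = \<bar>real_of_int (n * int c)\<bar> / real L"
        by (simp only: of_rat_divide of_rat_of_int_eq of_rat_of_nat_eq flip: of_int_abs)
      ultimately show ?thesis using L0 by (simp add: field_simps)
    qed
    then have "\<bar>real_of_int (n * int c)\<bar> \<le> real_of_int M"
      unfolding M_def using le_of_int_ceiling by (rule order.trans)
    then have "\<bar>n * int c\<bar> \<le> M" by (simp only: of_int_le_iff flip: of_int_abs)
    then have "n * int c \<in> {- M..M}" by auto
    ultimately show ?thesis by blast
  qed
  then have "?S \<subseteq> (\<lambda>a. of_int a / of_nat L) ` {- M..M}" by blast
  then show ?thesis by (rule finite_subset) simp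
qed

lemma finite_polys_bounded_degree:
  assumes "finite S"
  shows "finite {p. degree p \<le> d \<and> (\<forall>i. coeff p i \<in> S)}"
proof -
  have "p \<in> Poly ` {xs. set xs \<subseteq> S \<and> length xs \<le> Suc d}" if "degree p \<le> d" "\<forall>i. coeff p i \<in> S" for p
  proof (rule image_eqI)
    show "p = Poly (coeffs p)" by simp
    have "length (coeffs p) \<le> Suc (degree p)" by (cases "p = 0") (auto simp: length_coeffs_degree)
    moreover have "set (coeffs p) \<subseteq> S" using that(2) by (auto simp: coeffs_def)
    ultimately show "coeffs p \<in> {xs. set xs \<subseteq> S \<and> length xs \<le> Suc d}" using that(1) by auto
  qed
  then have "{p. degree p \<le> d \<and> (\<forall>i. coeff p i \<in> S)} \<subseteq> Poly ` {xs. set xs \<subseteq> S \<and> length xs \<le> Suc d}" by blast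
  then show ?thesis using finite_lists_length_le[OF assms] by (rule finite_subset[OF _ finite_imageI])
qed

text \<open>A further linear factor turns coefficients into \<open>- (x * c) + u\<close> with
  coefficients \<open>c\<close> and \<open>u\<close> of the shorter product, at a cost of at most
  \<open>B + 1 \<le> 2 * B\<close>. The estimate is crude but valid at every place.\<close>

lemma (in abs_value) coeff_prod_roots_le:
  assumes "B \<ge> 1" and "\<And>x. x \<in># M \<Longrightarrow> x \<in> F \<and> a x \<le> B"
  shows "coeff (\<Prod>x\<in>#M. [:- x, 1:]) k \<in> F \<and> a (coeff (\<Prod>x\<in>#M. [:- x, 1:]) k) \<le> (2 * B) ^ size M"
  using assms(2)
proof (induction M arbitrary: k)
  case empty
  show ?case using is_subringD[OF subring] by (cases "k = 0") auto
next
  case (add x M)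
  let ?q = "\<Prod>x\<in>#M. [:- x, 1:]"
  have IH: "coeff ?q k \<in> F" "a (coeff ?q k) \<le> (2 * B) ^ size M" for k using add.IH add.prems by auto
  have x: "x \<in> F" "a x \<le> B" using add.prems by auto
  define u where "u = (if k = 0 then 0 else coeff ?q (k - 1))"
  have u: "u \<in> F" "a u \<le> (2 * B) ^ size M" using IH assms(1) is_subringD[OF subring] by (auto simp: u_def)
  have eq: "coeff (\<Prod>x\<in>#add_mset x M. [:- x, 1:]) k = - (x * coeff ?q k) + u"
    by (cases k) (auto simp: u_def mult_pCons_left)
  have xq: "x * coeff ?q k \<in> F" using x IH is_subringD[OF subring] by blast
  have "a (- (x * coeff ?q k) + u) \<le> a (- (x * coeff ?q k)) + a u"
    using xq u is_subringD[OF subring] by (intro triangle) blast+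
  also have "\<dots> = a x * a (coeff ?q k) + a u" using xq x IH by (simp add: uminus mult)
  also have "\<dots> \<le> B * (2 * B) ^ size M + 1 * (2 * B) ^ size M"
    using x IH u assms(1) nonneg by (intro add_mono mult_mono) auto
  also have "\<dots> \<le> B * (2 * B) ^ size M + B * (2 * B) ^ size M"
    using assms(1) by (intro add_mono mult_right_mono) auto
  also have "\<dots> = (2 * B) ^ size (add_mset x M)" by (simp only: size_add_mset power_Suc mult.assoc)
  finally have "a (- (x * coeff ?q k) + u) \<le> (2 * B) ^ size (add_mset x M)" .
  then show ?case unfolding eq using xq u is_subringD[OF subring] by blast
qed

lemma minimal_rat_poly:
  assumes "p \<noteq> 0" "\<And>i. coeff p i \<in> \<rat>" "poly p (x::complex) = 0"
  obtains m where "lead_coeff m = 1" "\<And>i. coeff m i \<in> \<rat>" "poly m x = 0" "degree m \<le> degree p"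
    "\<forall>q. (\<forall>i. coeff q i \<in> \<rat>) \<and> q \<noteq> 0 \<and> poly q x = 0 \<longrightarrow> degree m \<le> degree q"
proof -
  let ?P = "\<lambda>q. (\<forall>i. coeff q i \<in> \<rat>) \<and> q \<noteq> 0 \<and> poly q x = 0"
  have "?P p" using assms by blast
  then obtain m where m: "?P m" "\<And>q. ?P q \<Longrightarrow> degree m \<le> degree q"
    using ex_has_least_nat[of ?P p degree] by blast
  let ?m = "smult (inverse (lead_coeff m)) m"
  have "lead_coeff m \<noteq> 0" using m(1) by simp
  show ?thesis
  proof (rule that)
    show "lead_coeff ?m = 1" "poly ?m x = 0" "degree ?m \<le> degree p"
      using m(1) m(2)[OF \<open>?P p\<close>] by auto
    have "coeff m i \<in> \<rat>" for i using m(1) by blast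
    then show "coeff ?m i \<in> \<rat>" for i unfolding coeff_smult by (intro Rats_mult Rats_inverse)
    show "\<forall>q. ?P q \<longrightarrow> degree ?m \<le> degree q" using m(2) \<open>lead_coeff m \<noteq> 0\<close> by simp
  qed
qed

text \<open>Each conjugate of \<open>b\<close> is the image of \<open>b\<close> under an embedding \<open>\<sigma>\<close>, and \<open>A \<circ> \<sigma>\<close> is again a normalized
  absolute value, so the hypothesis bounds all roots of the minimal polynomial.\<close>

lemma algebraic_conjugates_bounded_coeff:
  assumes m: "lead_coeff m = 1" "\<And>i. coeff m i \<in> \<rat>" "poly m b = 0"
    and min: "\<And>p. (\<And>i. coeff p i \<in> \<rat>) \<Longrightarrow> p \<noteq> 0 \<Longrightarrow> poly p b = 0 \<Longrightarrow> degree m \<le> degree p"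
    and B: "B \<ge> 1" "\<And>A. abs_value Qbar A \<Longrightarrow> normalized A \<Longrightarrow> A b \<le> B"
    and \<phi>: "\<phi> \<in> usual_abs_values" and c: "coeff m k = of_rat c"
  shows "\<phi> c \<le> (2 * B) ^ degree m"
proof -
  obtain A where A: "abs_value Qbar A" "\<And>q. A (of_rat q) = \<phi> q"
    by (rule exists_extension_usual_abs_value[OF \<phi>]) blast
  interpret abs_value Qbar A by (rule A(1))
  have "m \<noteq> 0" using m(1) by auto
  have roots: "x \<in> Qbar \<and> A x \<le> B" if "x \<in># proots m" for x
  proof -
    have x: "poly m x = 0" using that \<open>m \<noteq> 0\<close> by simp
    have xalg: "algebraic x" using m(2) \<open>m \<noteq> 0\<close> x by (rule algebraicI')
    have balg: "algebraic b" using m(2) \<open>m \<noteq> 0\<close> m(3) by (rule algebraicI')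
    obtain \<sigma> where \<sigma>: "\<sigma> b = x" "\<And>x y. algebraic x \<Longrightarrow> algebraic y \<Longrightarrow> \<sigma> (x + y) = \<sigma> x + \<sigma> y"
      "\<And>x y. algebraic x \<Longrightarrow> algebraic y \<Longrightarrow> \<sigma> (x * y) = \<sigma> x * \<sigma> y"
      "\<And>x. algebraic x \<Longrightarrow> algebraic (\<sigma> x)" "\<And>x. algebraic x \<Longrightarrow> \<sigma> x = 0 \<longleftrightarrow> x = 0"
      "\<And>q. \<sigma> (of_rat q) = of_rat q"
      by (rule conjugate_embedding[OF m(1,2,3) x min]) blast+
    have "abs_value Qbar (A \<circ> \<sigma>)"
      by unfold_locales (use Qbar_subring \<sigma> in \<open>auto simp: nonneg eq_0_iff mult triangle\<close>)
    moreover have "normalized (A \<circ> \<sigma>)" unfolding normalized_def using \<phi> A(2) \<sigma>(6) by auto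
    ultimately have "(A \<circ> \<sigma>) b \<le> B" by (rule B(2))
    then show ?thesis using \<sigma>(1) xalg by simp
  qed
  have "m = (\<Prod>x\<in>#proots m. [:- x, 1:])" using complex_poly_decompose_multiset[of m] m(1) by simp
  then have "A (coeff m k) \<le> (2 * B) ^ size (proots m)"
    using coeff_prod_roots_le[OF B(1) roots] by metis
  then show ?thesis by (simp add: c A(2) size_proots_complex)
qed

lemma northcott:
  assumes K: "number_field K" and B: "B \<ge> 1"
  shows "finite {b \<in> K. \<forall>A. abs_value Qbar A \<and> normalized A \<longrightarrow> A b \<le> B}" (is "finite ?S")
proof -
  obtain d where d: "\<And>x. x \<in> K \<Longrightarrow> \<exists>p. p \<noteq> 0 \<and> degree p \<le> d \<and> (\<forall>i. coeff p i \<in> \<rat>) \<and> poly p x = 0"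
    by (rule number_field_degree_bound[OF K]) blast
  \<comment> \<open>The exponent is \<open>d\<close>, not the degree of a single minimal polynomial,
    so that one finite set serves all \<open>b\<close>.\<close>
  define T where "T = {q. \<forall>\<phi>\<in>usual_abs_values. \<phi> q \<le> (2 * B) ^ d}"
  define PS where "PS = {p :: complex poly. degree p \<le> d \<and> (\<forall>i. coeff p i \<in> of_rat ` T)}"
  have "finite PS" unfolding PS_def T_def
    by (intro finite_polys_bounded_degree finite_imageI finite_rat_bounded_at_all_places)
  then have "finite (\<Union>p\<in>PS - {0}. {x. poly p x = 0})" by (auto intro: poly_roots_finite)
  moreover have "b \<in> (\<Union>p\<in>PS - {0}. {x. poly p x = 0})" if b: "b \<in> ?S" for b
  proof -
    have "b \<in> K" using b by blast
    from d[OF this] obtain p where p: "p \<noteq> 0" "degree p \<le> d" "\<And>i. coeff p i \<in> \<rat>" "poly p b = 0" by blast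
    obtain m where m: "lead_coeff m = 1" "\<And>i. coeff m i \<in> \<rat>" "poly m b = 0" "degree m \<le> degree p"
      "\<forall>q. (\<forall>i. coeff q i \<in> \<rat>) \<and> q \<noteq> 0 \<and> poly q b = 0 \<longrightarrow> degree m \<le> degree q"
      using minimal_rat_poly[OF p(1,3,4)] by metis
    have min: "degree m \<le> degree q" if "\<And>i. coeff q i \<in> \<rat>" "q \<noteq> 0" "poly q b = 0" for q
      using m(5) that by blast
    have "coeff m k \<in> of_rat ` T" for k
    proof -
      obtain c where c: "coeff m k = of_rat c" using m(2)[of k] by (auto elim: Rats_cases)
      have "\<phi> c \<le> (2 * B) ^ d" if \<phi>: "\<phi> \<in> usual_abs_values" for \<phi>
      proof -
        have "\<phi> c \<le> (2 * B) ^ degree m"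
          by (rule algebraic_conjugates_bounded_coeff[OF m(1,2,3) min B _ \<phi> c]) (use b in auto)
        also have "\<dots> \<le> (2 * B) ^ d" using m(4) p(2) B by (intro power_increasing) auto
        finally show ?thesis .
      qed
      then show ?thesis using c unfolding T_def by blast
    qed
    then have "m \<in> PS" using m(4) p(2) unfolding PS_def by simp
    moreover have "m \<noteq> 0" using m(1) by auto
    ultimately show ?thesis using m(3) by blast
  qed
  then have "?S \<subseteq> (\<Union>p\<in>PS - {0}. {x. poly p x = 0})" by (rule subsetI)
  ultimately show ?thesis by (rule finite_subset[rotated])
qed

text \<open>An integral polynomial for \<open>x\<close> has coefficients of value at most their
  usual size, and the value of its leading coefficient is bounded below at all places. Cauchy's
  bound thus depends on the polynomial alone, not on \<open>A\<close>.\<close>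

lemma normalized_abs_bounded:
  assumes "algebraic x"
  obtains C where "C \<ge> 1" "\<And>A. abs_value Qbar A \<Longrightarrow> normalized A \<Longrightarrow> A x \<le> C"
proof -
  obtain p where p: "\<And>i. coeff p i \<in> \<int>" "p \<noteq> 0" "poly p x = 0"
    using assms unfolding algebraic_def by blast
  have "\<forall>i. \<exists>k. coeff p i = of_int k"
  proof
    fix i show "\<exists>k. coeff p i = of_int k" using p(1)[of i] by (auto elim: Ints_cases)
  qed
  then obtain c where c: "\<And>i. coeff p i = of_int (c i)" by metis
  have lc: "c (degree p) \<noteq> 0" using p(2) c[of "degree p"] by auto
  define C where "C = max 1 ((\<Sum>j<degree p. real_of_int \<bar>c j\<bar>) * real_of_int \<bar>c (degree p)\<bar>)"
  have "A x \<le> C" if A: "abs_value Qbar A" "normalized A" for A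
  proof -
    interpret abs_value Qbar A by (rule A(1))
    obtain \<phi> where \<phi>: "\<phi> \<in> usual_abs_values" "\<And>q. A (of_rat q) = \<phi> q" using A(2) unfolding normalized_def by auto
    have le: "A (of_int k) \<le> real_of_int \<bar>k\<bar>" for k
    proof (cases "k \<ge> 0")
      case True
      then show ?thesis using of_nat_le[of "nat k"] by simp
    next
      case False
      then show ?thesis using of_nat_le[of "nat (- k)"] uminus[of "of_int k"] by simp
    qed
    have ge: "1 / real_of_int \<bar>c (degree p)\<bar> \<le> A (of_int (c (degree p)))"
      using usual_abs_value_of_int_ge[OF \<phi>(1) lc] \<phi>(2)[of "of_int (c (degree p))"] by simp
    have "A x \<le> max 1 ((\<Sum>j<degree p. A (coeff p j)) / A (lead_coeff p))"
      using p assms by (intro root_bound) (auto simp: c)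
    also have "(\<Sum>j<degree p. A (coeff p j)) / A (lead_coeff p)
      \<le> (\<Sum>j<degree p. real_of_int \<bar>c j\<bar>) / (1 / real_of_int \<bar>c (degree p)\<bar>)"
      unfolding c using ge le lc by (intro frac_le sum_mono sum_nonneg) auto
    finally show ?thesis by (simp add: C_def max.mono)
  qed
  then show ?thesis by (intro that[of C]) (auto simp: C_def)
qed

text \<open>An upper bound for the inverse of \<open>x\<close> is a lower bound for
  \<open>x\<close>.\<close>

lemma normalized_ln_abs_bounded:
  assumes x: "algebraic x" "x \<noteq> 0"
  obtains C where "\<And>A. abs_value Qbar A \<Longrightarrow> normalized A \<Longrightarrow> \<bar>ln (A x)\<bar> \<le> C"
proof -
  obtain C where C: "C \<ge> 1" "\<And>A. abs_value Qbar A \<Longrightarrow> normalized A \<Longrightarrow> A x \<le> C"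
    by (rule normalized_abs_bounded[OF x(1)]) blast
  obtain D where D: "D \<ge> 1" "\<And>A. abs_value Qbar A \<Longrightarrow> normalized A \<Longrightarrow> A (inverse x) \<le> D"
    by (rule normalized_abs_bounded[OF algebraic_inverse[OF x(1)]]) blast
  have "\<bar>ln (A x)\<bar> \<le> ln C + ln D" if A: "abs_value Qbar A" "normalized A" for A
  proof -
    interpret abs_value Qbar A by (rule A(1))
    have pos: "A x > 0" using nonneg[of x] eq_0_iff[of x] x by (auto simp: order.order_iff_strict)
    have "ln (A x) \<le> ln C" using C(2)[OF A] pos C(1) by simp
    moreover have "inverse (A x) \<le> D" 
    proof -
      have "A (inverse x) = inverse (A x)" using x(1) algebraic_inverse[OF x(1)] by (intro inverse) auto
      then show ?thesis using D(2)[OF A] by simp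
    qed
    then have "ln (inverse (A x)) \<le> ln D" using pos D(1) by (subst ln_le_cancel_iff) auto
    then have "- ln (A x) \<le> ln D" using pos by (simp add: ln_inverse)
    moreover have "ln C \<ge> 0" "ln D \<ge> 0" using C(1) D(1) by auto
    ultimately show ?thesis by linarith
  qed
  then show ?thesis by (rule that)
qed

text \<open>Negative exponents need inverses inside the subring \<open>F\<close>; assuming just
  these lets the lemma serve both \<open>K\<close> and all algebraic numbers.\<close>

lemma (in abs_value) ln_prod_powi:
  assumes "finite I" and x: "\<And>i. i \<in> I \<Longrightarrow> x i \<in> F" "\<And>i. i \<in> I \<Longrightarrow> x i \<noteq> 0" "\<And>i. i \<in> I \<Longrightarrow> Fields.inverse (x i) \<in> F"
  shows "(\<Prod>i\<in>I. x i powi k i) \<in> F" "a (\<Prod>i\<in>I. x i powi k i) > 0"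
    "ln (a (\<Prod>i\<in>I. x i powi k i)) = (\<Sum>i\<in>I. of_int (k i) * ln (a (x i)))"
proof -
  have pos: "a (x i) > 0" if "i \<in> I" for i
    using nonneg[of "x i"] eq_0_iff[of "x i"] x that by (auto simp: order.order_iff_strict)
  have mem: "x i powi k i \<in> F" if "i \<in> I" for i
    using x that is_subring_power[OF subring] by (auto simp: power_int_def)
  have pw: "a (x i powi k i) = a (x i) powi k i" if "i \<in> I" for i
    using x that by (auto simp: power_int_def power inverse simp flip: power_inverse)
  show "(\<Prod>i\<in>I. x i powi k i) \<in> F" using mem by (intro is_subring_prod[OF subring])
  have eq: "a (\<Prod>i\<in>I. x i powi k i) = (\<Prod>i\<in>I. a (x i) powi k i)" using mem by (simp add: prod pw)
  show "a (\<Prod>i\<in>I. x i powi k i) > 0" unfolding eq using pos by (intro prod_pos) auto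
  have "ln (\<Prod>i\<in>I. a (x i) powi k i) = (\<Sum>i\<in>I. ln (a (x i) powi k i))"
    using assms(1) pos by (intro ln_prod) force+
  also have "\<dots> = (\<Sum>i\<in>I. of_int (k i) * ln (a (x i)))"
  proof (rule sum.cong)
    fix i assume "i \<in> I"
    then have "a (x i) powi k i = a (x i) powr of_int (k i)"
      using pos by (subst powr_real_of_int') (auto simp: less_imp_le less_imp_neq[symmetric])
    then show "ln (a (x i) powi k i) = of_int (k i) * ln (a (x i))" by (simp add: ln_powr)
  qed simp
  finally show "ln (a (\<Prod>i\<in>I. x i powi k i)) = (\<Sum>i\<in>I. of_int (k i) * ln (a (x i)))" by (simp only: eq)
qed

theorem theorem1p3:
  fixes S :: "point set" and n :: nat and f :: "nat \<Rightarrow> point \<Rightarrow> real"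
  assumes "compactin Y_top S" and "openin Y_top S"
    and "Y_over \<rat> infinite_place \<subseteq> S"
    and "\<forall>i\<in>{1..n}. f i \<in> log_funs_supported S"
    and "\<exists>r :: nat \<Rightarrow> real. (\<exists>i\<in>{1..n}. r i \<noteq> 0) \<and>
           (\<forall>y\<in>topspace Y_top. (\<Sum>i=1..n. r i * f i y) = 0)"
  shows "\<exists>s :: nat \<Rightarrow> rat. (\<exists>i\<in>{1..n}. s i \<noteq> 0) \<and>
           (\<forall>y\<in>topspace Y_top. (\<Sum>i=1..n. of_rat (s i) * f i y) = 0)"
proof -
  have "\<forall>i\<in>{1..n}. \<exists>\<alpha>. algebraic \<alpha> \<and> \<alpha> \<noteq> 0 \<and> f i = log_fun \<alpha>"
    using assms(4) unfolding log_funs_supported_def log_funs_def by blast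
  then obtain \<alpha> where \<alpha>: "\<And>i. i \<in> {1..n} \<Longrightarrow> algebraic (\<alpha> i)" "\<And>i. i \<in> {1..n} \<Longrightarrow> \<alpha> i \<noteq> 0"
    "\<And>i. i \<in> {1..n} \<Longrightarrow> f i = log_fun (\<alpha> i)" by metis
  obtain r i0 where i0: "i0 \<in> {1..n}" "r i0 \<noteq> (0::real)"
    and rel: "\<And>y. y \<in> topspace Y_top \<Longrightarrow> (\<Sum>i=1..n. r i * f i y) = 0" using assms(5) by blast
  obtain K where K: "number_field K" "\<alpha> ` {1..n} \<subseteq> K"
    by (rule number_field_containing_finite[of "\<alpha> ` {1..n}"]) (use \<alpha>(1) in auto)
  have \<alpha>K: "\<alpha> i \<in> K" "inverse (\<alpha> i) \<in> K" if "i \<in> {1..n}" for i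
  proof -
    show "\<alpha> i \<in> K" using K(2) that by blast
    then show "inverse (\<alpha> i) \<in> K" by (rule number_field_inverse[OF K(1)])
  qed
  have "\<forall>i\<in>{1..n}. \<exists>C. \<forall>A. abs_value Qbar A \<and> normalized A \<longrightarrow> \<bar>ln (A (\<alpha> i))\<bar> \<le> C"
  proof
    fix i assume i: "i \<in> {1..n}"
    obtain C where "\<And>A. abs_value Qbar A \<Longrightarrow> normalized A \<Longrightarrow> \<bar>ln (A (\<alpha> i))\<bar> \<le> C"
      by (rule normalized_ln_abs_bounded[OF \<alpha>(1,2)[OF i]]) blast
    then show "\<exists>C. \<forall>A. abs_value Qbar A \<and> normalized A \<longrightarrow> \<bar>ln (A (\<alpha> i))\<bar> \<le> C" by blast
  qed
  then obtain C where C: "\<And>i A. i \<in> {1..n} \<Longrightarrow> abs_value Qbar A \<Longrightarrow> normalized A \<Longrightarrow> \<bar>ln (A (\<alpha> i))\<bar> \<le> C i"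
    by metis
  \<comment> \<open>Each rounding error is at most 1/2 and multiplies a logarithm of size at most
    \<open>C i\<close>, so this bound depends neither on \<open>N\<close> nor on the place.\<close>
  define B where "B = exp (\<Sum>i=1..n. \<bar>C i\<bar>)"
  have B: "B \<ge> 1" unfolding B_def by (simp add: sum_nonneg)
  \<comment> \<open>Consecutive multiples of \<open>M * r i0\<close> then differ by more than 1, so
    rounding cannot merge them.\<close>
  obtain M :: nat where M: "real M * \<bar>r i0\<bar> > 1" using reals_Archimedean3[of "\<bar>r i0\<bar>"] i0(2) by auto
  define s where "s = (\<lambda>N i. round (real N * real M * r i))"
  define \<beta> where "\<beta> = (\<lambda>N. \<Prod>i=1..n. \<alpha> i powi s N i)"
  \<comment> \<open>The real relation is given on points, so \<open>A\<close> is first realized as a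
    point.\<close>
  have relA: "(\<Sum>i=1..n. r i * ln (A (\<alpha> i))) = 0" if A: "abs_value Qbar A" "normalized A" for A
  proof -
    obtain y where y: "y \<in> topspace Y_top" "\<And>x. algebraic x \<Longrightarrow> point_abs y x = A x"
      by (rule point_of_abs_value[OF A]) blast
    have "(\<Sum>i=1..n. r i * f i y) = (\<Sum>i=1..n. r i * ln (A (\<alpha> i)))"
      using \<alpha> y by (intro sum.cong) (auto simp: log_fun_def)
    then show ?thesis using rel[OF y(1)] by simp
  qed
  have \<beta>_bound: "A (\<beta> N) \<le> B" if A: "abs_value Qbar A" "normalized A" for A N
  proof -
    interpret abs_value Qbar A by (rule A(1))
    have pos: "A (\<beta> N) > 0"
      unfolding \<beta>_def using \<alpha>(1,2) by (intro ln_prod_powi) auto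
    have "ln (A (\<beta> N)) = (\<Sum>i=1..n. of_int (s N i) * ln (A (\<alpha> i)))"
      unfolding \<beta>_def using \<alpha>(1,2) by (intro ln_prod_powi) auto
    \<comment> \<open>Subtracting a multiple of the vanishing real relation leaves only rounding
      errors as coefficients.\<close>
    also have "(\<Sum>i=1..n. of_int (s N i) * ln (A (\<alpha> i)))
      = (\<Sum>i=1..n. of_int (s N i) * ln (A (\<alpha> i))) - real N * real M * (\<Sum>i=1..n. r i * ln (A (\<alpha> i)))"
      by (simp only: relA[OF A] mult_zero_right diff_zero)
    also have "\<dots> = (\<Sum>i=1..n. (of_int (s N i) - real N * real M * r i) * ln (A (\<alpha> i)))"
      by (simp add: sum_distrib_left sum_subtractf[symmetric] algebra_simps)
    also have "\<dots> \<le> (\<Sum>i=1..n. \<bar>C i\<bar>)"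
    proof (rule sum_mono)
      fix i assume i: "i \<in> {1..n}"
      have "\<bar>of_int (s N i) - real N * real M * r i\<bar> \<le> 1 / 2" unfolding s_def by (rule of_int_round_abs_le)
      moreover have "\<bar>ln (A (\<alpha> i))\<bar> \<le> \<bar>C i\<bar>" using C[OF i A] by simp
      ultimately have "\<bar>of_int (s N i) - real N * real M * r i\<bar> * \<bar>ln (A (\<alpha> i))\<bar> \<le> 1 * \<bar>C i\<bar>"
        by (intro mult_mono) auto
      then show "(of_int (s N i) - real N * real M * r i) * ln (A (\<alpha> i)) \<le> \<bar>C i\<bar>"
        by (simp add: abs_mult[symmetric])
    qed
    finally have "ln (A (\<beta> N)) \<le> (\<Sum>i=1..n. \<bar>C i\<bar>)" .
    then have "exp (ln (A (\<beta> N))) \<le> B" unfolding B_def by simp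
    then show ?thesis using pos by simp
  qed
  have "\<beta> N \<in> K" for N
    unfolding \<beta>_def using \<alpha>K number_field_subring[OF K(1)]
    by (auto simp: power_int_def intro!: is_subring_prod is_subring_power)
  then have "range \<beta> \<subseteq> {b \<in> K. \<forall>A. abs_value Qbar A \<and> normalized A \<longrightarrow> A b \<le> B}"
    using \<beta>_bound by blast
  then have "finite (range \<beta>)" using northcott[OF K(1) B] by (rule finite_subset)
  then have "\<not> inj \<beta>" using finite_imageD infinite_UNIV_nat by blast
  then obtain N N' where N: "N \<noteq> N'" "\<beta> N = \<beta> N'" unfolding inj_on_def by blast
  define e where "e = (\<lambda>i. s N i - s N' i)"
  have e0: "e i0 \<noteq> 0"
  proof
    assume "e i0 = 0"
    then have eq: "s N i0 = s N' i0" by (simp add: e_def)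
    have 1: "\<bar>of_int (s N i0) - real N * real M * r i0\<bar> \<le> 1 / 2" unfolding s_def by (rule of_int_round_abs_le)
    have 2: "\<bar>of_int (s N' i0) - real N' * real M * r i0\<bar> \<le> 1 / 2" unfolding s_def by (rule of_int_round_abs_le)
    \<comment> \<open>Both multiples lie within 1/2 of the same integer.\<close>
    have "\<bar>real N * real M * r i0 - real N' * real M * r i0\<bar> \<le> 1" using 1 2 unfolding eq by linarith
    also have "real N * real M * r i0 - real N' * real M * r i0 = (real N - real N') * (real M * r i0)"
      by (simp add: algebra_simps)
    finally have "\<bar>real N - real N'\<bar> * (real M * \<bar>r i0\<bar>) \<le> 1" by (simp add: abs_mult)
    moreover have "1 \<le> \<bar>real N - real N'\<bar>" using N(1) by linarith
    then have "1 * (real M * \<bar>r i0\<bar>) \<le> \<bar>real N - real N'\<bar> * (real M * \<bar>r i0\<bar>)" by (intro mult_right_mono) auto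
    ultimately show False using M by linarith
  qed
  \<comment> \<open>At an arbitrary point the value on \<open>K\<close> suffices, since all
    \<open>\<alpha> i\<close> lie in \<open>K\<close>; no extension to the algebraic numbers is
    involved.\<close>
  have "(\<Sum>i=1..n. of_rat (of_int (e i)) * f i y) = 0" if y: "y \<in> topspace Y_top" for y
  proof -
    have yK: "y K \<in> places K" using y K(1) unfolding topspace_Y_top compatible_families_def by auto
    let ?a = "place_abs (y K)"
    interpret abs_value K ?a
      using place_abs(3)[OF K(1) yK] nontrivial_abs_values_iff[OF number_field_subring[OF K(1)]] by blast
    have ln: "ln (?a (\<beta> N)) = (\<Sum>i=1..n. of_int (s N i) * ln (?a (\<alpha> i)))" for N
      unfolding \<beta>_def using \<alpha>(2) \<alpha>K by (intro ln_prod_powi) auto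
    have "f i y = ln (?a (\<alpha> i))" if "i \<in> {1..n}" for i
      using \<alpha>(3)[OF that] y point_abs_eq[OF y K(1) \<alpha>K(1)[OF that]] by (simp add: log_fun_def)
    then have "(\<Sum>i=1..n. of_rat (of_int (e i)) * f i y) = (\<Sum>i=1..n. of_int (e i) * ln (?a (\<alpha> i)))"
      by (intro sum.cong) auto
    also have "\<dots> = ln (?a (\<beta> N)) - ln (?a (\<beta> N'))"
      by (simp add: ln e_def left_diff_distrib sum_subtractf)
    also have "\<dots> = 0" using N(2) by simp
    finally show ?thesis .
  qed
  then show ?thesis using i0(1) e0 by (intro exI[of _ "\<lambda>i. of_int (e i)"]) auto
qed

end
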